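(* Let $n$, $N$, $p$ be positive integers, let $A_1,\dots,A_N\in\mathbb{R}^{n\times n}$, and let $Q\in\mathbb{R}^{N\times N}$ be the infinitesimal generator of a continuous-time Markov process with values in $\{1,\dots,N\}$. For each positive integer $m$ define $$\mathcal U_m=\sup_{W_1,\dots,W_N\in\mathbb{R}^{m\times m}}\big\{\mu(\hat{\mathcal T})\colon \Sigma_{d,W}\text{ is stable}\big\},\qquad \hat{\mathcal T}=Q^\top\otimes I_{(mn)_p}+\operatorname{diag}\big((W_1\oplus A_1)_{[p]},\dots,(W_N\oplus A_N)_{[p]}\big),$$ where $\Sigma_{d,W}$ is the deterministic switched linear system $dy/dt=W_{\sigma(t)}y(t)$, $y(0)=y_0$. Let $m$ and $m'$ be positive integers. If $m<m'$, then $\mathcal U_m\le\mathcal U_{m'}$.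
   Context: $\|\cdot\|$ is the Euclidean norm of vectors. $I_k$ is the $k\times k$ identity matrix, $\otimes$ is the Kronecker product, and $\operatorname{diag}(M_1,\dots,M_N)$ is the block-diagonal matrix with diagonal blocks $M_1,\dots,M_N$. For square matrices $A$ (of order $n$) and $B$ (of order $m$), the Kronecker sum is $A\oplus B=A\otimes I_m+I_n\otimes B$; thus $W_i\oplus A_i=W_i\otimes I_n+I_m\otimes A_i$. The spectral abscissa $\mu(M)$ of a real square matrix $M$ is the maximum real part of its eigenvalues. For positive integers $k,p$ put $k_p=\binom{k+p-1}{p}$. For $x\in\mathbb{R}^k$, $x^{[p]}\in\mathbb{R}^{k_p}$ is the vector whose entries are all the monomials of degree $p$ in $x_1,\dots,x_k$, in lexicographic order, with positive coefficients chosen so that $\|x^{[p]}\|=\|x\|^p$ (i.e. the coefficient of $x_1^{\alpha_1}\cdots x_k^{\alpha_k}$ is $\sqrt{p!/(\alpha_1!\cdots\alpha_k!)}$). For $A\in\mathbb{R}^{k\times k}$, $A_{[p]}$ is the unique $k_p\times k_p$ matrix such that whenever an $\mathbb{R}^k$-valued function $x$ satisfies $dx/dt=Ax$, the function $x^{[p]}$ satisfies $dx^{[p]}/dt=A_{[p]}x^{[p]}$. The deterministic switched linear system $dy/dt=W_{\sigma(t)}y(t)$, $y(0)=y_0$, is stable if there exists $C>0$ such that $\|y(t)\|\le C\|y_0\|$ for all $y_0\in\mathbb{R}^m$, all $t\ge0$ and all piecewise constant switching signals $\sigma:[0,\infty)\to\{1,\dots,N\}$. The supremum is taken in the extended real line.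 *)

theory Defs
  imports
    "Jordan_Normal_Form.Spectral_Radius"
    "HOL-Library.Extended_Real"
begin

text \<open>Matrices and vectors are those of the Jordan normal form library, whose dimensions are
  terms, so that the order of the matrices can vary inside a statement.  Everything is indexed
  from 0: the modes are \<open>0, \<dots>, N - 1\<close>.\<close>

definition kron :: "'a::semiring_0 mat \<Rightarrow> 'a mat \<Rightarrow> 'a mat" where
  "kron A B = mat (dim_row A * dim_row B) (dim_col A * dim_col B)
     (\<lambda>(i, j). A $$ (i div dim_row B, j div dim_col B) * B $$ (i mod dim_row B, j mod dim_col B))"

definition kron_sum :: "'a::semiring_1 mat \<Rightarrow> 'a mat \<Rightarrow> 'a mat" where
  "kron_sum A B = kron A (1\<^sub>m (dim_row B)) + kron (1\<^sub>m (dim_row A)) B"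

definition spectral_abscissa :: "real mat \<Rightarrow> real" where
  "spectral_abscissa M = Max (Re ` spectrum (map_mat complex_of_real M))"

definition vec_norm2 :: "real vec \<Rightarrow> real" where
  "vec_norm2 x = sqrt (x \<bullet> x)"

definition has_vec_derivative_in :: "nat \<Rightarrow> (real \<Rightarrow> real vec) \<Rightarrow> real vec \<Rightarrow> real filter \<Rightarrow> bool" where
  "has_vec_derivative_in k x v F \<longleftrightarrow> (\<forall>i<k. ((\<lambda>t. x t $ i) has_real_derivative v $ i) F)"


subsection \<open>Lifted vectors and matrices\<close>

definition lift_dim :: "nat \<Rightarrow> nat \<Rightarrow> nat" where
  "lift_dim k p = (k + p - 1) choose p"

text \<open>The exponents of the monomials of degree \<open>p\<close> in \<open>k\<close> variables in lexicographic order,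
  that is, \<open>x\<^sub>1\<^sup>p, x\<^sub>1\<^sup>p\<^sup>-\<^sup>1 x\<^sub>2, \<dots>, x\<^sub>k\<^sup>p\<close>.\<close>

fun multi_indices :: "nat \<Rightarrow> nat \<Rightarrow> nat list list" where
  "multi_indices 0 p = (if p = 0 then [[]] else [])"
| "multi_indices (Suc k) p = concat (map (\<lambda>a. map ((#) a) (multi_indices k (p - a))) (rev [0..<Suc p]))"

definition lift_vec :: "nat \<Rightarrow> real vec \<Rightarrow> real vec" where
  "lift_vec p x = vec (lift_dim (dim_vec x) p) (\<lambda>r.
     let \<alpha> = multi_indices (dim_vec x) p ! r in
       sqrt (fact p / (\<Prod>j<dim_vec x. fact (\<alpha> ! j))) * (\<Prod>j<dim_vec x. (x $ j) ^ (\<alpha> ! j)))"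

definition lift_mat :: "nat \<Rightarrow> real mat \<Rightarrow> real mat" where
  "lift_mat p A = (let k = dim_row A; kp = lift_dim k p in
     THE B. B \<in> carrier_mat kp kp \<and>
       (\<forall>x. (\<forall>t. x t \<in> carrier_vec k) \<and> (\<forall>t. has_vec_derivative_in k x (A *\<^sub>v x t) (at t)) \<longrightarrow>
            (\<forall>t. has_vec_derivative_in kp (\<lambda>s. lift_vec p (x s)) (B *\<^sub>v lift_vec p (x t)) (at t))))"

lemma set_multi_indices: "set (multi_indices k p) = {\<alpha>. length \<alpha> = k \<and> sum_list \<alpha> = p}"
proof (induction k arbitrary: p)
  case 0
  then show ?case by auto
next
  case (Suc k)
  show ?case
  proof (intro Set.set_eqI iffI)
    fix \<alpha> assume "\<alpha> \<in> set (multi_indices (Suc k) p)"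
    then show "\<alpha> \<in> {\<alpha>. length \<alpha> = Suc k \<and> sum_list \<alpha> = p}" by (auto simp: Suc.IH)
  next
    fix \<alpha> assume a: "\<alpha> \<in> {\<alpha>. length \<alpha> = Suc k \<and> sum_list \<alpha> = p}"
    then obtain a \<beta> where "\<alpha> = a # \<beta>" by (cases \<alpha>) auto
    with a show "\<alpha> \<in> set (multi_indices (Suc k) p)"
      by (auto simp: Suc.IH intro!: bexI[of _ a])
  qed
qed

lemma sorted_multi_indices:
  "sorted_wrt (\<lambda>\<alpha> \<beta>. (\<beta>, \<alpha>) \<in> lexord less_than) (multi_indices k p)"
proof (induction k arbitrary: p)
  case 0
  then show ?case by auto
next
  case (Suc k)
  have "sorted_wrt (\<lambda>\<alpha> \<beta>. (\<beta>, \<alpha>) \<in> lexord less_than)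
          (concat (map (\<lambda>a. map ((#) a) (multi_indices k (p - a))) as))"
    if "sorted_wrt (>) as" for as
    using that
  proof (induction as)
    case Nil
    then show ?case by simp
  next
    case (Cons a as)
    then show ?case
      using Suc.IH[of "p - a"] by (fastforce simp: sorted_wrt_append sorted_wrt_map)
  qed
  moreover have "sorted_wrt (>) (rev [0..<Suc p])"
    by (simp add: sorted_wrt_rev del: upt_Suc)
  ultimately show ?case by (simp del: upt_Suc)
qed

lemma distinct_multi_indices: "distinct (multi_indices k p)"
proof -
  have "distinct as" if "sorted_wrt (\<lambda>\<alpha> \<beta>. (\<beta>, \<alpha>) \<in> lexord less_than) as" for as :: "nat list list"
    using that by (induction as) (use lexord_irreflexive[of less_than] in auto)
  then show ?thesis using sorted_multi_indices by blast
qed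

lemma length_multi_indices: "length (multi_indices k p) = lift_dim k p"
proof (induction k arbitrary: p)
  case 0
  then show ?case by (auto simp: lift_dim_def)
next
  case (Suc k)
  have "length (multi_indices (Suc k) p) = (\<Sum>a\<leftarrow>rev [0..<Suc p]. length (multi_indices k (p - a)))"
    by (simp add: length_concat o_def del: upt_Suc)
  also have "\<dots> = (\<Sum>a\<leftarrow>[0..<Suc p]. length (multi_indices k (p - a)))"
    by (metis rev_map sum_list_rev)
  also have "\<dots> = (\<Sum>a\<le>p. length (multi_indices k (p - a)))"
    by (simp add: sum_set_upt_conv_sum_list_nat[symmetric] atLeast0LessThan lessThan_Suc_atMost del: upt_Suc)
  also have "\<dots> = (\<Sum>b\<le>p. length (multi_indices k b))"
    by (rule sum.nat_diff_reindex[of "\<lambda>b. length (multi_indices k b)" "Suc p", simplified lessThan_Suc_atMost, simplified])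
  also have "\<dots> = (\<Sum>b\<le>p. (k + b - 1) choose b)"
    by (simp add: Suc.IH lift_dim_def)
  also have "\<dots> = (k + p) choose p"
  proof (cases k)
    case 0
    have "(\<Sum>b\<le>p. (b - 1) choose b) = (\<Sum>b\<le>p. if b = 0 then 1 else 0)"
      by (rule sum.cong) auto
    with 0 show ?thesis by simp
  next
    case (Suc j)
    then show ?thesis using sum_choose_lower[of j p] by simp
  qed
  finally show ?case by (simp add: lift_dim_def)
qed

lemma sum_multi_indices:
  fixes y :: "nat \<Rightarrow> real"
  shows "(\<Sum>\<alpha>\<in>set (multi_indices k p). fact p / (\<Prod>j<k. fact (\<alpha> ! j)) * (\<Prod>j<k. y j ^ (\<alpha> ! j)))
         = (\<Sum>j<k. y j) ^ p"
proof (induction k arbitrary: p y)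
  case 0
  show ?case by (cases "p = 0") (simp_all)
next
  case (Suc k)
  let ?S = "Sigma {..p} (\<lambda>a. set (multi_indices k (p - a)))"
  let ?f = "\<lambda>\<alpha>. fact p / (\<Prod>j<Suc k. fact (\<alpha> ! j)) * (\<Prod>j<Suc k. y j ^ (\<alpha> ! j)) :: real"
  have img: "set (multi_indices (Suc k) p) = (\<lambda>(a, \<beta>). a # \<beta>) ` ?S"
    by (force simp: image_iff atMost_def simp del: upt_Suc)
  have inj: "inj_on (\<lambda>(a, \<beta>). a # \<beta>) ?S" by (auto simp: inj_on_def)
  have "sum ?f (set (multi_indices (Suc k) p)) = (\<Sum>(a, \<beta>)\<in>?S. ?f (a # \<beta>))"
    unfolding img by (subst sum.reindex[OF inj]) (simp add: case_prod_beta')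
  also have "\<dots> = (\<Sum>a\<le>p. \<Sum>\<beta>\<in>set (multi_indices k (p - a)). ?f (a # \<beta>))"
    by (subst sum.Sigma) auto
  also have "\<dots> = (\<Sum>a\<le>p. of_nat (p choose a) * y 0 ^ a * (\<Sum>j<k. y (Suc j)) ^ (p - a))"
  proof (rule sum.cong[OF refl])
    fix a assume a: "a \<in> {..p}"
    have "?f (a # \<beta>) = of_nat (p choose a) * y 0 ^ a *
            (fact (p - a) / (\<Prod>j<k. fact (\<beta> ! j)) * (\<Prod>j<k. y (Suc j) ^ (\<beta> ! j)))" for \<beta>
      using a by (simp add: prod.lessThan_Suc_shift binomial_fact field_simps del: prod.lessThan_Suc)
    then show "(\<Sum>\<beta>\<in>set (multi_indices k (p - a)). ?f (a # \<beta>)) =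
        of_nat (p choose a) * y 0 ^ a * (\<Sum>j<k. y (Suc j)) ^ (p - a)"
      by (simp only: sum_distrib_left[symmetric] Suc.IH)
  qed
  also have "\<dots> = (y 0 + (\<Sum>j<k. y (Suc j))) ^ p"
    by (rule binomial_ring[symmetric])
  also have "\<dots> = (\<Sum>j<Suc k. y j) ^ p"
    by (simp only: sum.lessThan_Suc_shift)
  finally show ?case .
qed

lemma norm_lift_vec: "vec_norm2 (lift_vec p x) = vec_norm2 x ^ p"
proof -
  let ?k = "dim_vec x"
  let ?g = "\<lambda>\<alpha>. fact p / (\<Prod>j<?k. fact (\<alpha> ! j)) * (\<Prod>j<?k. ((x $ j)\<^sup>2) ^ (\<alpha> ! j)) :: real"
  have sq: "(sqrt (fact p / (\<Prod>j<?k. fact (\<alpha> ! j))) * (\<Prod>j<?k. (x $ j) ^ (\<alpha> ! j)))\<^sup>2 = ?g \<alpha>" for \<alpha> :: "nat list"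
    by (simp add: power_mult_distrib prod_nonneg prod_power_distrib power_mult[symmetric] mult.commute)
  have "lift_vec p x \<bullet> lift_vec p x = (\<Sum>r<lift_dim ?k p. ?g (multi_indices ?k p ! r))"
    unfolding scalar_prod_def
    by (rule sum.cong) (simp_all add: lift_vec_def Let_def sq atLeast0LessThan flip: power2_eq_square)
  also have "\<dots> = sum ?g (set (multi_indices ?k p))"
    by (rule sum.reindex_bij_betw[OF bij_betw_nth]) (auto simp: distinct_multi_indices length_multi_indices)
  also have "\<dots> = (x \<bullet> x) ^ p"
    by (subst sum_multi_indices) (simp add: scalar_prod_def power2_eq_square atLeast0LessThan)
  finally show ?thesis by (simp add: vec_norm2_def real_sqrt_power)
qed


subsection \<open>Generators of Markov processes\<close>

text \<open>\<open>P t\<close> is the matrix of the transition probabilities in time \<open>t\<close> of a time-homogeneous process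
  (entry \<open>(i, j)\<close> for the transition from \<open>i\<close> to \<open>j\<close>), and the infinitesimal generator is the
  derivative of \<open>P\<close> at time 0.\<close>

definition markov_transition_function :: "nat \<Rightarrow> (real \<Rightarrow> real mat) \<Rightarrow> bool" where
  "markov_transition_function N P \<longleftrightarrow>
     (\<forall>t\<ge>0. P t \<in> carrier_mat N N \<and> (\<forall>i<N. (\<forall>j<N. P t $$ (i, j) \<ge> 0) \<and> (\<Sum>j<N. P t $$ (i, j)) = 1)) \<and>
     P 0 = 1\<^sub>m N \<and>
     (\<forall>s\<ge>0. \<forall>t\<ge>0. P (s + t) = P s * P t)"

definition markov_generator :: "nat \<Rightarrow> real mat \<Rightarrow> bool" where
  "markov_generator N Q \<longleftrightarrow> Q \<in> carrier_mat N N \<and>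
     (\<exists>P. markov_transition_function N P \<and>
       (\<forall>i<N. \<forall>j<N. ((\<lambda>t. P t $$ (i, j)) has_real_derivative Q $$ (i, j)) (at 0 within {0..})))"


subsection \<open>Deterministic switched linear systems\<close>

definition locally_finite_times :: "real set \<Rightarrow> bool" where
  "locally_finite_times D \<longleftrightarrow> (\<forall>T. finite (D \<inter> {0..T}))"

definition switching_signal :: "nat \<Rightarrow> (real \<Rightarrow> nat) \<Rightarrow> bool" where
  "switching_signal N \<sigma> \<longleftrightarrow> (\<forall>t\<ge>0. \<sigma> t < N) \<and>
     (\<exists>D. locally_finite_times D \<and>
       (\<forall>a b. 0 \<le> a \<and> a < b \<and> {a<..<b} \<inter> D = {} \<longrightarrow> (\<exists>i. \<forall>t\<in>{a<..<b}. \<sigma> t = i)))"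

text \<open>A solution is continuous and satisfies the differential equation except at the
  switching times.\<close>

definition switched_solution ::
    "nat \<Rightarrow> (nat \<Rightarrow> real mat) \<Rightarrow> (real \<Rightarrow> nat) \<Rightarrow> (real \<Rightarrow> real vec) \<Rightarrow> bool" where
  "switched_solution m W \<sigma> y \<longleftrightarrow>
     (\<forall>t\<ge>0. y t \<in> carrier_vec m) \<and>
     (\<forall>i<m. continuous_on {0..} (\<lambda>t. y t $ i)) \<and>
     (\<exists>D. locally_finite_times D \<and>
       (\<forall>t\<in>{0..} - D. has_vec_derivative_in m y (W (\<sigma> t) *\<^sub>v y t) (at t within {0..})))"

definition switched_stable :: "nat \<Rightarrow> nat \<Rightarrow> (nat \<Rightarrow> real mat) \<Rightarrow> bool" where
  "switched_stable m N W \<longleftrightarrow>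
     (\<exists>C>0. \<forall>\<sigma> y. switching_signal N \<sigma> \<and> switched_solution m W \<sigma> y \<longrightarrow>
        (\<forall>t\<ge>0. vec_norm2 (y t) \<le> C * vec_norm2 (y 0)))"


definition T_hat :: "nat \<Rightarrow> nat \<Rightarrow> nat \<Rightarrow> (nat \<Rightarrow> real mat) \<Rightarrow> real mat \<Rightarrow> nat \<Rightarrow> (nat \<Rightarrow> real mat) \<Rightarrow> real mat" where
  "T_hat n N p A Q m W =
     kron (transpose_mat Q) (1\<^sub>m (lift_dim (m * n) p))
     + diag_block_mat (map (\<lambda>i. lift_mat p (kron_sum (W i) (A i))) [0..<N])"

definition sup_abscissa :: "nat \<Rightarrow> nat \<Rightarrow> nat \<Rightarrow> (nat \<Rightarrow> real mat) \<Rightarrow> real mat \<Rightarrow> nat \<Rightarrow> ereal" where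
  "sup_abscissa n N p A Q m =
     (SUP W \<in> {W. (\<forall>i<N. W i \<in> carrier_mat m m) \<and> switched_stable m N W}.
        ereal (spectral_abscissa (T_hat n N p A Q m W)))"

end

theory Submission
  imports Defs
begin

text \<open>Pad each \<open>W\<^sub>i\<close> with zeros to a matrix of order \<open>m'\<close>. The system gains coordinates that stay
  constant along every solution, so it remains stable. It suffices to show that every eigenvalue of
  the matrix \<open>T\<close> built from the \<open>W\<^sub>i\<close> is an eigenvalue of the matrix \<open>T'\<close> built from the padded
  matrices: the spectral abscissa then cannot decrease, and every competitor in the supremum for \<open>m\<close>
  is matched by one in the supremum for \<open>m'\<close>.

  The Kronecker sum of the padded matrix with \<open>A\<^sub>i\<close> maps a vector \<open>(x, 0)\<close>, where \<open>x\<close> has \<open>mn\<close> entries,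
  to \<open>((W\<^sub>i \<oplus> A\<^sub>i) x, 0)\<close>. Hence \<open>(x, 0)\<close> is a solution of the padded system whenever \<open>x\<close> is one of the
  original system. The entries of \<open>(x, 0)\<^sup>[\<^sup>p\<^sup>]\<close> are those of \<open>x\<^sup>[\<^sup>p\<^sup>]\<close>, at the positions of the
  monomials in the first \<open>mn\<close> variables, and zeros. Comparing derivatives shows that the lifted
  padded matrix acts on vectors supported at these positions exactly as \<open>(W\<^sub>i \<oplus> A\<^sub>i)\<^sub>[\<^sub>p\<^sub>]\<close> does
  (\<open>lift_mat_extends\<close>). The same relation
  then holds between \<open>T\<close> and \<open>T'\<close> (\<open>block_diagonal_extends\<close>), so an eigenvector of \<open>T\<close> extended by
  zeros is an eigenvector of \<open>T'\<close> for the same eigenvalue (\<open>spectrum_extends\<close>).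

  As \<open>A\<^sub>[\<^sub>p\<^sub>]\<close> is defined by a unique description, its existence and uniqueness have to be proved.
  It exists since the derivative of a monomial along \<open>Ax\<close> is homogeneous of the same degree
  (\<open>generates_lift_exists\<close>). It is unique since monomials are linearly independent
  (\<open>lift_vec_independent\<close>) and a solution passes through every point
  (\<open>linear_ode_solution_exists\<close>).\<close>

section \<open>Linear differential equations\<close>

lemma mult_mat_vec_nth:
  assumes "A \<in> carrier_mat r c" "v \<in> carrier_vec c" "i < r"
  shows "(A *\<^sub>v v) $ i = (\<Sum>j<c. A $$ (i, j) * v $ j)"
  using assms by (simp add: scalar_prod_def atLeast0LessThan)

text \<open>The solution is \<open>e\<^sup>t\<^sup>A x\<^sub>0\<close>, written entrywise as the power series with coefficients
  \<open>(A\<^sup>n x\<^sub>0)\<^sub>i / n!\<close>. It is needed because the lifted matrix is characterised by its action along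
  solutions, and a solution through every point makes this determine the matrix.\<close>

lemma linear_ode_solution_exists:
  fixes A :: "real mat"
  assumes A: "A \<in> carrier_mat k k" and x0: "x0 \<in> carrier_vec k"
  obtains x where "\<And>t. x t \<in> carrier_vec k" "x 0 = x0"
    "\<And>t. has_vec_derivative_in k x (A *\<^sub>v x t) (at t)"
proof -
  define g where "g n = ((\<lambda>v. A *\<^sub>v v) ^^ n) x0" for n
  define M where "M = (\<Sum>i<k. \<Sum>j<k. \<bar>A $$ (i, j)\<bar>)"
  define R where "R = (\<Sum>i<k. \<bar>x0 $ i\<bar>)"
  define c where "c i n = g n $ i / fact n" for i n
  have g0: "g 0 = x0" and gSuc: "g (Suc n) = A *\<^sub>v g n" for n
    by (simp_all add: g_def)
  have g: "g n \<in> carrier_vec k" for n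
    by (induction n) (use A x0 in \<open>auto simp: g0 gSuc\<close>)
  have bound: "\<bar>g n $ i\<bar> \<le> M ^ n * R" if "i < k" for n i
    using that
  proof (induction n arbitrary: i)
    case 0
    then show ?case
      unfolding g0 R_def by (auto intro!: member_le_sum[of i "{..<k}" "\<lambda>i. \<bar>x0 $ i\<bar>"])
  next
    case (Suc n)
    have MR: "0 \<le> M ^ n * R" by (auto simp: M_def R_def intro!: mult_nonneg_nonneg sum_nonneg zero_le_power)
    have "\<bar>g (Suc n) $ i\<bar> \<le> (\<Sum>j<k. \<bar>A $$ (i, j) * g n $ j\<bar>)"
      unfolding gSuc mult_mat_vec_nth[OF A g Suc.prems] by (rule sum_abs)
    also have "\<dots> \<le> (\<Sum>j<k. \<bar>A $$ (i, j)\<bar> * (M ^ n * R))"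
      by (rule sum_mono) (auto simp: abs_mult intro!: mult_left_mono Suc.IH)
    also have "\<dots> = (\<Sum>j<k. \<bar>A $$ (i, j)\<bar>) * (M ^ n * R)"
      by (simp add: sum_distrib_right)
    also have "\<dots> \<le> M * (M ^ n * R)"
      unfolding M_def using Suc.prems MR[unfolded M_def]
      by (intro mult_right_mono member_le_sum[of i "{..<k}" "\<lambda>i. \<Sum>j<k. \<bar>A $$ (i, j)\<bar>"])
        (auto intro: sum_nonneg)
    finally show ?case by (simp add: mult_ac)
  qed
  have summable: "summable (\<lambda>n. c i n * y ^ n)" if "i < k" for i y
  proof (rule summable_comparison_test')
    show "summable (\<lambda>n. R * (inverse (fact n) * (M * \<bar>y\<bar>) ^ n))"
      by (intro summable_mult summable_exp)
    show "norm (c i n * y ^ n) \<le> R * (inverse (fact n) * (M * \<bar>y\<bar>) ^ n)" for n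
    proof -
      have "norm (c i n * y ^ n) = \<bar>g n $ i\<bar> * (inverse (fact n) * \<bar>y\<bar> ^ n)"
        by (simp add: c_def abs_mult power_abs divide_inverse)
      also have "\<dots> \<le> (M ^ n * R) * (inverse (fact n) * \<bar>y\<bar> ^ n)"
        by (intro mult_right_mono bound that) auto
      finally show ?thesis by (simp add: power_mult_distrib mult_ac)
    qed
  qed
  define f where "f i t = (\<Sum>n. c i n * t ^ n)" for i t
  have deriv: "(f i has_real_derivative (\<Sum>j<k. A $$ (i, j) * f j t)) (at t)" if i: "i < k" for i t
  proof -
    have diffs: "diffs (c i) n = (\<Sum>j<k. A $$ (i, j) * c j n)" for n
    proof -
      have "diffs (c i) n = g (Suc n) $ i / fact n"
        by (simp add: diffs_def c_def del: of_nat_Suc)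
      also have "\<dots> = (\<Sum>j<k. A $$ (i, j) * c j n)"
        unfolding gSuc mult_mat_vec_nth[OF A g i] by (simp add: c_def sum_divide_distrib)
      finally show ?thesis .
    qed
    have "(\<lambda>n. \<Sum>j<k. A $$ (i, j) * (c j n * t ^ n)) sums (\<Sum>j<k. A $$ (i, j) * f j t)"
      unfolding f_def by (intro sums_sum sums_mult summable_sums summable) auto
    then have "(\<Sum>n. diffs (c i) n * t ^ n) = (\<Sum>j<k. A $$ (i, j) * f j t)"
      by (simp add: diffs sum_distrib_right mult.assoc sums_iff)
    with termdiffs_strong_converges_everywhere[OF summable[OF i], of t] show ?thesis
      by (simp add: f_def[abs_def])
  qed
  define x where "x t = vec k (\<lambda>i. f i t)" for t
  have x: "x t \<in> carrier_vec k" for t by (simp add: x_def)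
  show thesis
  proof (rule that[of x])
    show "x t \<in> carrier_vec k" for t by (rule x)
    have "f i 0 = x0 $ i" for i
      unfolding f_def powser_zero by (simp add: c_def g0)
    then show "x 0 = x0"
      using x0 by (intro eq_vecI) (auto simp: x_def)
    show "has_vec_derivative_in k x (A *\<^sub>v x t) (at t)" for t
      unfolding has_vec_derivative_in_def mult_mat_vec_nth[OF A x]
    proof (intro allI impI)
      fix i assume i: "i < k"
      have "(\<lambda>t. x t $ i) = f i" using i by (auto simp: x_def)
      then show "((\<lambda>t. x t $ i) has_real_derivative (A *\<^sub>v x t) $ i) (at t)"
        using deriv[OF i, of t] by (simp add: mult_mat_vec_nth[OF A x i]) (simp add: x_def)
    qed
  qed
qed

section \<open>Linear independence of the monomials\<close>

definition monomial :: "nat list \<Rightarrow> real vec \<Rightarrow> real" where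
  "monomial \<alpha> x = (\<Prod>j<dim_vec x. x $ j ^ (\<alpha> ! j))"

definition lift_coeff :: "nat list \<Rightarrow> real" where
  "lift_coeff \<alpha> = sqrt (fact (sum_list \<alpha>) / (\<Prod>j<length \<alpha>. fact (\<alpha> ! j)))"

lemma lift_coeff_pos: "lift_coeff \<alpha> > 0"
  by (simp add: lift_coeff_def prod_pos)

lemma multi_indices_nth:
  assumes "r < lift_dim k p"
  shows "length (multi_indices k p ! r) = k" "sum_list (multi_indices k p ! r) = p"
  using assms nth_mem[of r "multi_indices k p"] by (auto simp: set_multi_indices length_multi_indices)

lemma multi_indices_nth_ex:
  assumes "length \<alpha> = k" "sum_list \<alpha> = p"
  obtains r where "r < lift_dim k p" "multi_indices k p ! r = \<alpha>"
  using assms by (metis (mono_tags, lifting) in_set_conv_nth length_multi_indices mem_Collect_eq set_multi_indices)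

lemma lift_vec_nth:
  assumes "x \<in> carrier_vec k" "r < lift_dim k p"
  shows "lift_vec p x $ r = lift_coeff (multi_indices k p ! r) * monomial (multi_indices k p ! r) x"
  using assms multi_indices_nth[OF assms(2)]
  by (simp add: lift_vec_def Let_def lift_coeff_def monomial_def)

lemma lift_vec_carrier: "x \<in> carrier_vec k \<Longrightarrow> lift_vec p x \<in> carrier_vec (lift_dim k p)"
  by (rule carrier_vecI) (simp add: lift_vec_def)

text \<open>Induction on the number of variables: for fixed values of the other variables, the sum is a
  polynomial in the first variable that vanishes identically, so each of its coefficients, a
  combination of monomials in one variable fewer, vanishes.\<close>

lemma monomials_independent:
  fixes b :: "nat list \<Rightarrow> real"
  assumes "\<And>y :: nat \<Rightarrow> real. (\<Sum>\<alpha>\<in>set (multi_indices k p). b \<alpha> * (\<Prod>j<k. y j ^ (\<alpha> ! j))) = 0"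
    and "\<alpha> \<in> set (multi_indices k p)"
  shows "b \<alpha> = 0"
  using assms
proof (induction k arbitrary: p b \<alpha>)
  case 0
  then show ?case by (auto split: if_splits)
next
  case (Suc k)
  let ?S = "Sigma {..p} (\<lambda>a. set (multi_indices k (p - a)))"
  let ?c = "\<lambda>y a. \<Sum>\<beta>\<in>set (multi_indices k (p - a)). b (a # \<beta>) * (\<Prod>j<k. y j ^ (\<beta> ! j))"
  have img: "set (multi_indices (Suc k) p) = (\<lambda>(a, \<beta>). a # \<beta>) ` ?S"
    by (force simp: image_iff atMost_def simp del: upt_Suc)
  have inj: "inj_on (\<lambda>(a, \<beta>). a # \<beta>) ?S" by (auto simp: inj_on_def)
  have poly: "(\<Sum>a\<le>p. ?c y a * w ^ a) = 0" for y :: "nat \<Rightarrow> real" and w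
  proof -
    \<comment> \<open>\<open>w\<close> is the value of the first variable, \<open>y\<close> lists those of the others.\<close>
    let ?y = "case_nat w y"
    have "0 = (\<Sum>\<alpha>\<in>set (multi_indices (Suc k) p). b \<alpha> * (\<Prod>j<Suc k. ?y j ^ (\<alpha> ! j)))"
      using Suc.prems(1) by simp
    also have "\<dots> = (\<Sum>(a, \<beta>)\<in>?S. b (a # \<beta>) * (\<Prod>j<Suc k. ?y j ^ ((a # \<beta>) ! j)))"
      unfolding img by (subst sum.reindex[OF inj]) (simp add: case_prod_beta')
    also have "\<dots> = (\<Sum>a\<le>p. \<Sum>\<beta>\<in>set (multi_indices k (p - a)).
        b (a # \<beta>) * (\<Prod>j<Suc k. ?y j ^ ((a # \<beta>) ! j)))"
      by (subst sum.Sigma) auto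
    also have "\<dots> = (\<Sum>a\<le>p. ?c y a * w ^ a)"
      by (simp add: prod.lessThan_Suc_shift sum_distrib_left mult_ac del: prod.lessThan_Suc)
    finally show ?thesis by simp
  qed
  obtain a \<beta> where \<alpha>: "\<alpha> = a # \<beta>" "a \<le> p" "\<beta> \<in> set (multi_indices k (p - a))"
    using Suc.prems(2) unfolding img by auto
  have "?c y a = 0" for y :: "nat \<Rightarrow> real"
    using zero_polynom_imp_zero_coeffs[of "?c y" p a, OF poly \<alpha>(2)] .
  then show ?case
    using Suc.IH[where p = "p - a" and b = "\<lambda>\<beta>. b (a # \<beta>)" and \<alpha> = \<beta>] \<alpha> by blast
qed

lemma lift_vec_independent:
  assumes "\<And>x. x \<in> carrier_vec k \<Longrightarrow> (\<Sum>r<lift_dim k p. b r * lift_vec p x $ r) = 0"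
    and r: "r < lift_dim k p"
  shows "b r = 0"
proof -
  let ?MI = "multi_indices k p"
  have bij: "bij_betw ((!) ?MI) {..<lift_dim k p} (set ?MI)"
    by (rule bij_betw_nth) (auto simp: distinct_multi_indices length_multi_indices)
  \<comment> \<open>The coefficients have to be indexed by exponents instead of positions, and \<open>lift_coeff\<close> is
    absorbed into them.\<close>
  define b' where "b' \<alpha> = b (the_inv_into {..<lift_dim k p} ((!) ?MI) \<alpha>) * lift_coeff \<alpha>" for \<alpha>
  have b': "b' (?MI ! s) = b s * lift_coeff (?MI ! s)" if "s < lift_dim k p" for s
    using that bij by (simp add: b'_def the_inv_into_f_f bij_betw_def)
  have "(\<Sum>\<alpha>\<in>set ?MI. b' \<alpha> * (\<Prod>j<k. y j ^ (\<alpha> ! j))) = 0" for y :: "nat \<Rightarrow> real"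
  proof -
    have "(\<Sum>\<alpha>\<in>set ?MI. b' \<alpha> * (\<Prod>j<k. y j ^ (\<alpha> ! j))) =
        (\<Sum>s<lift_dim k p. b' (?MI ! s) * (\<Prod>j<k. y j ^ (?MI ! s ! j)))"
      by (rule sum.reindex_bij_betw[OF bij, symmetric])
    also have "\<dots> = (\<Sum>s<lift_dim k p. b s * lift_vec p (vec k y) $ s)"
      by (rule sum.cong) (auto simp: b' lift_vec_nth[of _ k] monomial_def)
    finally show ?thesis using assms(1)[of "vec k y"] by simp
  qed
  then have "b' (?MI ! r) = 0"
    by (rule monomials_independent) (use r in \<open>auto simp: length_multi_indices\<close>)
  with b'[OF r] lift_coeff_pos[of "?MI ! r"] show ?thesis by simp
qed

section \<open>Existence and uniqueness of the lifted matrix\<close>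

text \<open>The functions on \<open>\<real>\<^sup>k\<close> that are linear combinations of the entries of \<open>x\<^sup>[\<^sup>p\<^sup>]\<close>, that is, the
  homogeneous polynomial functions of degree \<open>p\<close>. That the lifted matrix exists follows from
  closure properties of this span.\<close>

definition lift_span :: "nat \<Rightarrow> nat \<Rightarrow> (real vec \<Rightarrow> real) set" where
  "lift_span k p = {f. \<exists>b. \<forall>x\<in>carrier_vec k. f x = (\<Sum>r<lift_dim k p. b r * lift_vec p x $ r)}"

lemma lift_span_scale: "f \<in> lift_span k p \<Longrightarrow> (\<lambda>x. a * f x) \<in> lift_span k p"
proof -
  assume "f \<in> lift_span k p"
  then obtain b where b: "\<forall>x\<in>carrier_vec k. f x = (\<Sum>r<lift_dim k p. b r * lift_vec p x $ r)"
    by (auto simp: lift_span_def)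
  show ?thesis unfolding lift_span_def
    using b by (auto intro!: exI[of _ "\<lambda>r. a * b r"] simp: sum_distrib_left mult.assoc)
qed

lemma lift_span_sum:
  assumes "\<And>i. i \<in> I \<Longrightarrow> f i \<in> lift_span k p"
  shows "(\<lambda>x. \<Sum>i\<in>I. f i x) \<in> lift_span k p"
proof -
  have "\<forall>i\<in>I. \<exists>b. \<forall>x\<in>carrier_vec k. f i x = (\<Sum>r<lift_dim k p. b r * lift_vec p x $ r)"
    using assms by (auto simp: lift_span_def)
  then obtain b where
    b: "\<forall>i\<in>I. \<forall>x\<in>carrier_vec k. f i x = (\<Sum>r<lift_dim k p. b i r * lift_vec p x $ r)"
    by metis
  have "(\<Sum>i\<in>I. f i x) = (\<Sum>r<lift_dim k p. (\<Sum>i\<in>I. b i r) * lift_vec p x $ r)"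
    if "x \<in> carrier_vec k" for x
    using b that by (simp add: sum_distrib_right) (rule sum.swap)
  then show ?thesis unfolding lift_span_def by (auto intro!: exI[of _ "\<lambda>r. \<Sum>i\<in>I. b i r"])
qed

lemma monomial_in_lift_span:
  assumes "length \<alpha> = k" "sum_list \<alpha> = p"
  shows "monomial \<alpha> \<in> lift_span k p"
proof -
  obtain r where r: "r < lift_dim k p" "multi_indices k p ! r = \<alpha>"
    using multi_indices_nth_ex[OF assms] .
  have "monomial \<alpha> x = (\<Sum>s<lift_dim k p. (if s = r then 1 / lift_coeff \<alpha> else 0) * lift_vec p x $ s)"
    if "x \<in> carrier_vec k" for x
    using r lift_coeff_pos[of \<alpha>] lift_vec_nth[OF that r(1)]
    by (simp add: if_distrib[of "\<lambda>u. u * _"] cong: if_cong)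
  then show ?thesis unfolding lift_span_def
    by (auto intro!: exI[of _ "\<lambda>s. if s = r then 1 / lift_coeff \<alpha> else 0"])
qed

lemma monomial_split:
  assumes "x \<in> carrier_vec k" "j < k"
  shows "monomial \<alpha> x = x $ j ^ (\<alpha> ! j) * (\<Prod>i\<in>{..<k} - {j}. x $ i ^ (\<alpha> ! i))"
  using assms by (simp add: monomial_def prod.remove[of "{..<k}" j])

lemma monomial_derivative:
  assumes \<alpha>: "length \<alpha> = k"
    and x: "\<And>t. x t \<in> carrier_vec k" and d: "has_vec_derivative_in k x v (at t)"
  shows "((\<lambda>s. monomial \<alpha> (x s)) has_real_derivative
    (\<Sum>j<k. v $ j * (of_nat (\<alpha> ! j) * (monomial (\<alpha>[j := \<alpha> ! j - 1]) (x t))))) (at t)"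
proof -
  have "((\<lambda>s. \<Prod>j<k. x s $ j ^ (\<alpha> ! j)) has_real_derivative
    (\<Sum>j<k. (of_nat (\<alpha> ! j) * (v $ j * x t $ j ^ (\<alpha> ! j - 1)))
       * (\<Prod>i\<in>{..<k} - {j}. x t $ i ^ (\<alpha> ! i)))) (at t)"
  proof (rule has_field_derivative_prod)
    fix j assume "j \<in> {..<k}"
    then have "((\<lambda>s. x s $ j) has_real_derivative v $ j) (at t)"
      using d by (auto simp: has_vec_derivative_in_def)
    from DERIV_power[OF this, of "\<alpha> ! j"]
    show "((\<lambda>s. x s $ j ^ (\<alpha> ! j)) has_real_derivative
        of_nat (\<alpha> ! j) * (v $ j * x t $ j ^ (\<alpha> ! j - 1))) (at t)" by simp
  qed
  moreover have "(\<lambda>s. \<Prod>j<k. x s $ j ^ (\<alpha> ! j)) = (\<lambda>s. monomial \<alpha> (x s))"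
    using x carrier_vecD by (force simp: monomial_def)
  moreover have "(\<Sum>j<k. (of_nat (\<alpha> ! j) * (v $ j * x t $ j ^ (\<alpha> ! j - 1)))
       * (\<Prod>i\<in>{..<k} - {j}. x t $ i ^ (\<alpha> ! i))) =
      (\<Sum>j<k. v $ j * (of_nat (\<alpha> ! j) * (monomial (\<alpha>[j := \<alpha> ! j - 1]) (x t))))"
  proof (rule sum.cong)
    fix j assume j: "j \<in> {..<k}"
    have "(\<Prod>i\<in>{..<k} - {j}. x t $ i ^ (\<alpha>[j := \<alpha> ! j - 1] ! i)) = (\<Prod>i\<in>{..<k} - {j}. x t $ i ^ (\<alpha> ! i))"
      by (rule prod.cong) auto
    then show "(of_nat (\<alpha> ! j) * (v $ j * x t $ j ^ (\<alpha> ! j - 1))) * (\<Prod>i\<in>{..<k} - {j}. x t $ i ^ (\<alpha> ! i))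
      = v $ j * (of_nat (\<alpha> ! j) * (monomial (\<alpha>[j := \<alpha> ! j - 1]) (x t)))"
      using j \<alpha> by (simp add: monomial_split[OF x, of j])
  qed simp
  ultimately show ?thesis by (simp only:)
qed

text \<open>Differentiating \<open>x\<^sup>\<alpha>\<close> along \<open>Ax\<close> trades one factor \<open>x\<^sub>j\<close> for a factor \<open>x\<^sub>l\<close>, which keeps the
  degree. The factor \<open>x\<^sub>j\<close> must be present, since the subtraction of exponents is truncated.\<close>

lemma monomial_shift:
  assumes \<alpha>: "length \<alpha> = k" "sum_list \<alpha> = p" and j: "j < k" and l: "l < k" and pos: "\<alpha> ! j > 0"
  obtains \<beta> where "length \<beta> = k" "sum_list \<beta> = p"
    "\<And>x. x \<in> carrier_vec k \<Longrightarrow> x $ l * monomial (\<alpha>[j := \<alpha> ! j - 1]) x = monomial \<beta> x"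
proof -
  let ?\<gamma> = "\<alpha>[j := \<alpha> ! j - 1]"
  let ?\<beta> = "?\<gamma>[l := Suc (?\<gamma> ! l)]"
  have "\<alpha> ! j \<le> sum_list \<alpha>" using j \<alpha> by (intro member_le_sum_list) auto
  then have "sum_list ?\<gamma> = p - 1"
    using \<alpha> j pos by (simp add: sum_list_update)
  moreover have "?\<gamma> ! l \<le> sum_list ?\<gamma>" using l \<alpha> by (intro member_le_sum_list) auto
  ultimately have "sum_list ?\<beta> = p"
    using \<alpha> l pos \<open>\<alpha> ! j \<le> sum_list \<alpha>\<close> by (subst sum_list_update) auto
  moreover have "x $ l * monomial ?\<gamma> x = monomial ?\<beta> x" if x: "x \<in> carrier_vec k" for x
  proof -
    have "(\<Prod>i\<in>{..<k} - {l}. x $ i ^ (?\<beta> ! i)) = (\<Prod>i\<in>{..<k} - {l}. x $ i ^ (?\<gamma> ! i))"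
      by (rule prod.cong) auto
    then show ?thesis using l \<alpha> by (simp add: monomial_split[OF x l])
  qed
  ultimately show thesis using that[of ?\<beta>] \<alpha> by simp
qed

lemma monomial_derivative_in_lift_span:
  assumes A: "A \<in> carrier_mat k k" and \<alpha>: "length \<alpha> = k" "sum_list \<alpha> = p"
  shows "(\<lambda>x. \<Sum>j<k. (A *\<^sub>v x) $ j * (of_nat (\<alpha> ! j) * monomial (\<alpha>[j := \<alpha> ! j - 1]) x)) \<in> lift_span k p"
proof -
  let ?h = "\<lambda>j l x. A $$ (j, l) * of_nat (\<alpha> ! j) * (x $ l * monomial (\<alpha>[j := \<alpha> ! j - 1]) x)"
  have "?h j l \<in> lift_span k p" if jl: "j < k" "l < k" for j l
  proof (cases "\<alpha> ! j = 0")
    case True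
    then show ?thesis unfolding lift_span_def by (auto intro!: exI[of _ "\<lambda>_. 0"])
  next
    case False
    then obtain \<beta> where \<beta>: "length \<beta> = k" "sum_list \<beta> = p"
      "\<And>x. x \<in> carrier_vec k \<Longrightarrow> x $ l * monomial (\<alpha>[j := \<alpha> ! j - 1]) x = monomial \<beta> x"
      using monomial_shift[OF \<alpha> jl] by blast
    have "(\<lambda>x. A $$ (j, l) * of_nat (\<alpha> ! j) * monomial \<beta> x) \<in> lift_span k p"
      by (intro lift_span_scale monomial_in_lift_span \<beta>)
    then show ?thesis using \<beta>(3) by (simp add: lift_span_def)
  qed
  then have "(\<lambda>x. \<Sum>j<k. \<Sum>l<k. ?h j l x) \<in> lift_span k p"
    by (intro lift_span_sum) auto
  moreover have "(\<Sum>j<k. \<Sum>l<k. ?h j l x) =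
      (\<Sum>j<k. (A *\<^sub>v x) $ j * (of_nat (\<alpha> ! j) * monomial (\<alpha>[j := \<alpha> ! j - 1]) x))"
    if x: "x \<in> carrier_vec k" for x
    by (rule sum.cong) (auto simp: mult_mat_vec_nth[OF A x] sum_distrib_left sum_distrib_right mult_ac)
  ultimately show ?thesis by (simp add: lift_span_def)
qed

text \<open>The property that singles out \<open>A\<^sub>[\<^sub>p\<^sub>]\<close> in its definition by unique description.\<close>

definition generates_lift :: "nat \<Rightarrow> nat \<Rightarrow> real mat \<Rightarrow> real mat \<Rightarrow> bool" where
  "generates_lift k p A B \<longleftrightarrow> B \<in> carrier_mat (lift_dim k p) (lift_dim k p) \<and>
     (\<forall>x. (\<forall>t. x t \<in> carrier_vec k) \<and> (\<forall>t. has_vec_derivative_in k x (A *\<^sub>v x t) (at t)) \<longrightarrow>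
        (\<forall>t. has_vec_derivative_in (lift_dim k p) (\<lambda>s. lift_vec p (x s)) (B *\<^sub>v lift_vec p (x t)) (at t)))"

lemma generates_lift_nth:
  assumes "generates_lift k p A B" "\<And>t. x t \<in> carrier_vec k"
    "\<And>t. has_vec_derivative_in k x (A *\<^sub>v x t) (at t)" "r < lift_dim k p"
  shows "((\<lambda>s. lift_vec p (x s) $ r) has_real_derivative
    (\<Sum>c<lift_dim k p. B $$ (r, c) * lift_vec p (x t) $ c)) (at t)"
proof -
  have B: "B \<in> carrier_mat (lift_dim k p) (lift_dim k p)"
    using assms(1) unfolding generates_lift_def by (rule conjunct1)
  have "has_vec_derivative_in (lift_dim k p) (\<lambda>s. lift_vec p (x s)) (B *\<^sub>v lift_vec p (x t)) (at t)"
    by (rule assms(1)[unfolded generates_lift_def, THEN conjunct2, THEN spec, THEN mp, THEN spec])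
      (intro conjI allI assms(2,3))
  from this[unfolded has_vec_derivative_in_def, THEN spec, THEN mp, OF assms(4)]
  show ?thesis
    by (simp only: mult_mat_vec_nth[OF B lift_vec_carrier[OF assms(2)] assms(4)])
qed

text \<open>Each entry of \<open>x\<^sup>[\<^sup>p\<^sup>]\<close> has, along solutions, a derivative that is again homogeneous of degree
  \<open>p\<close> in \<open>x\<close>; its coefficients in the entries of \<open>x\<^sup>[\<^sup>p\<^sup>]\<close> form a row of the matrix.\<close>

lemma generates_lift_exists:
  assumes A: "A \<in> carrier_mat k k"
  obtains B where "generates_lift k p A B"
proof -
  let ?K = "lift_dim k p" and ?MI = "multi_indices k p"
  define D where "D r x = lift_coeff (?MI ! r) *
    (\<Sum>j<k. (A *\<^sub>v x) $ j * (of_nat (?MI ! r ! j) * monomial ((?MI ! r)[j := ?MI ! r ! j - 1]) x))"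
    for r x
  have "D r \<in> lift_span k p" if "r < ?K" for r
    unfolding D_def
    by (intro lift_span_scale monomial_derivative_in_lift_span A multi_indices_nth that)
  then have "\<forall>r. \<exists>b. r < ?K \<longrightarrow> (\<forall>x\<in>carrier_vec k. D r x = (\<Sum>c<?K. b c * lift_vec p x $ c))"
    unfolding lift_span_def by blast
  from choice[OF this] obtain b where b: "\<And>r x. r < ?K \<Longrightarrow> x \<in> carrier_vec k \<Longrightarrow>
      D r x = (\<Sum>c<?K. b r c * lift_vec p x $ c)"
    by blast
  let ?B = "mat ?K ?K (\<lambda>(r, c). b r c)"
  show thesis
  proof (rule that[of ?B], unfold generates_lift_def, intro conjI allI impI; (elim conjE)?)
    show B: "?B \<in> carrier_mat ?K ?K" by simp
    fix x :: "real \<Rightarrow> real vec" and t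
    assume "\<forall>t. x t \<in> carrier_vec k" and "\<forall>t. has_vec_derivative_in k x (A *\<^sub>v x t) (at t)"
    then have x: "\<And>t. x t \<in> carrier_vec k" and d: "has_vec_derivative_in k x (A *\<^sub>v x t) (at t)"
      by auto
    show "has_vec_derivative_in ?K (\<lambda>s. lift_vec p (x s)) (?B *\<^sub>v lift_vec p (x t)) (at t)"
      unfolding has_vec_derivative_in_def
    proof (intro allI impI)
      fix r assume r: "r < ?K"
      have "((\<lambda>s. lift_coeff (?MI ! r) * monomial (?MI ! r) (x s)) has_real_derivative D r (x t)) (at t)"
        unfolding D_def by (intro DERIV_cmult monomial_derivative x d multi_indices_nth r)
      moreover have "D r (x t) = (?B *\<^sub>v lift_vec p (x t)) $ r"
        unfolding b[OF r x] mult_mat_vec_nth[OF B lift_vec_carrier[OF x] r] using r by simp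
      ultimately show "((\<lambda>s. lift_vec p (x s) $ r) has_real_derivative (?B *\<^sub>v lift_vec p (x t)) $ r) (at t)"
        by (simp only: lift_vec_nth[OF x r])
    qed
  qed
qed

text \<open>Two such matrices agree on \<open>x\<^sub>0\<^sup>[\<^sup>p\<^sup>]\<close> for the initial value \<open>x\<^sub>0\<close> of any solution, hence for every
  \<open>x\<^sub>0\<close>, and the entries of \<open>x\<^sub>0\<^sup>[\<^sup>p\<^sup>]\<close> are linearly independent functions of \<open>x\<^sub>0\<close>.\<close>

lemma generates_lift_unique:
  assumes A: "A \<in> carrier_mat k k" and B: "generates_lift k p A B" and B': "generates_lift k p A B'"
  shows "B = B'"
proof (rule eq_matI)
  let ?K = "lift_dim k p"
  have dims: "B \<in> carrier_mat ?K ?K" "B' \<in> carrier_mat ?K ?K"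
    by (rule B[unfolded generates_lift_def, THEN conjunct1] B'[unfolded generates_lift_def, THEN conjunct1])+
  then show "dim_row B = dim_row B'" "dim_col B = dim_col B'" by auto
  fix r c assume "r < dim_row B'" "c < dim_col B'"
  then have r: "r < ?K" and c: "c < ?K" using dims by auto
  have "(\<Sum>s<?K. (B $$ (r, s) - B' $$ (r, s)) * lift_vec p x0 $ s) = 0"
    if x0: "x0 \<in> carrier_vec k" for x0
  proof -
    obtain x where x: "\<And>t. x t \<in> carrier_vec k" "x 0 = x0"
      "\<And>t. has_vec_derivative_in k x (A *\<^sub>v x t) (at t)"
      using linear_ode_solution_exists[OF A x0] by blast
    show ?thesis
      using DERIV_unique[OF generates_lift_nth[OF B x(1,3) r, of 0] generates_lift_nth[OF B' x(1,3) r]]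
      by (simp add: x(2) left_diff_distrib sum_subtractf)
  qed
  from lift_vec_independent[OF this c] show "B $$ (r, c) = B' $$ (r, c)" by simp
qed

lemma generates_lift_lift_mat:
  assumes A: "A \<in> carrier_mat k k"
  shows "generates_lift k p A (lift_mat p A)"
proof -
  have "lift_mat p A = (THE B. generates_lift k p A B)"
    unfolding lift_mat_def generates_lift_def Let_def carrier_matD(1)[OF A] ..
  moreover obtain B where B: "generates_lift k p A B" using generates_lift_exists[OF A] .
  moreover have "(THE B. generates_lift k p A B) = B"
    using B by (rule the_equality) (rule generates_lift_unique[OF A _ B])
  ultimately show ?thesis by (simp only:)
qed

lemma lift_mat_carrier:
  "A \<in> carrier_mat k k \<Longrightarrow> lift_mat p A \<in> carrier_mat (lift_dim k p) (lift_dim k p)"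
  by (rule generates_lift_lift_mat[unfolded generates_lift_def, THEN conjunct1])

section \<open>Lifts of extended systems\<close>

lemma prod_extend_ones:
  fixes g :: "nat \<Rightarrow> real"
  assumes "\<And>j. k \<le> j \<Longrightarrow> j < k + d \<Longrightarrow> g j = 1"
  shows "(\<Prod>j<k + d. g j) = (\<Prod>j<k. g j)"
  by (rule prod.mono_neutral_right) (use assms in auto)

lemma monomial_append_zeros:
  assumes "length \<alpha> = k" "x \<in> carrier_vec k"
  shows "monomial (\<alpha> @ replicate d 0) (x @\<^sub>v 0\<^sub>v d) = monomial \<alpha> x"
proof -
  have "monomial (\<alpha> @ replicate d 0) (x @\<^sub>v 0\<^sub>v d) =
      (\<Prod>j<k + d. if j < k then x $ j ^ (\<alpha> ! j) else 1)"
    unfolding monomial_def using assms by (intro prod.cong) (auto simp: nth_append)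
  also have "\<dots> = (\<Prod>j<k. x $ j ^ (\<alpha> ! j))"
    by (subst prod_extend_ones) auto
  finally show ?thesis using assms by (simp add: monomial_def)
qed

lemma monomial_append_nonzero:
  assumes "x \<in> carrier_vec k" "j < d" "\<alpha> ! (k + j) > 0"
  shows "monomial \<alpha> (x @\<^sub>v 0\<^sub>v d) = 0"
  unfolding monomial_def using assms by (intro prod_zero bexI[of _ "k + j"]) auto

lemma lift_coeff_append_zeros: "lift_coeff (\<alpha> @ replicate d 0) = lift_coeff \<alpha>"
proof -
  have "(\<Prod>j<length \<alpha> + d. fact ((\<alpha> @ replicate d 0) ! j)) = (\<Prod>j<length \<alpha>. fact (\<alpha> ! j) :: real)"
    by (subst prod_extend_ones) (auto simp: nth_append intro!: prod.cong)
  then show ?thesis by (simp add: lift_coeff_def sum_list_replicate)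
qed

text \<open>A monomial in \<open>k + d\<close> variables is, on vectors \<open>(x, 0)\<close>, a monomial of \<open>x\<close> with the same
  normalising coefficient if it involves the first \<open>k\<close> variables only, and zero otherwise. The map
  \<open>\<epsilon>\<close> sends the position of a monomial in \<open>k\<close> variables to its position among those in \<open>k + d\<close>
  variables.\<close>

lemma lift_vec_append_zeros:
  fixes k d p :: nat
  obtains \<epsilon> where "inj_on \<epsilon> {..<lift_dim k p}" "\<epsilon> ` {..<lift_dim k p} \<subseteq> {..<lift_dim (k + d) p}"
    "\<And>x r. x \<in> carrier_vec k \<Longrightarrow> r < lift_dim k p \<Longrightarrow>
      lift_vec p (x @\<^sub>v 0\<^sub>v d) $ \<epsilon> r = lift_vec p x $ r"
    "\<And>x r. x \<in> carrier_vec k \<Longrightarrow> r < lift_dim (k + d) p \<Longrightarrow> r \<notin> \<epsilon> ` {..<lift_dim k p} \<Longrightarrow>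
      lift_vec p (x @\<^sub>v 0\<^sub>v d) $ r = 0"
proof -
  let ?MI = "multi_indices k p" and ?MI' = "multi_indices (k + d) p"
  have "\<exists>r'. r < lift_dim k p \<longrightarrow> r' < lift_dim (k + d) p \<and> ?MI' ! r' = ?MI ! r @ replicate d 0" for r
    using multi_indices_nth[of r k p] multi_indices_nth_ex[of "?MI ! r @ replicate d 0" "k + d" p]
    by (metis length_append length_replicate sum_list_append sum_list_replicate add.right_neutral mult_zero_right)
  then obtain \<epsilon> where \<epsilon>: "\<And>r. r < lift_dim k p \<Longrightarrow>
      \<epsilon> r < lift_dim (k + d) p \<and> ?MI' ! \<epsilon> r = ?MI ! r @ replicate d 0"
    by metis
  have append_carrier: "x @\<^sub>v 0\<^sub>v d \<in> carrier_vec (k + d)" if "x \<in> carrier_vec k" for x :: "real vec"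
    using that by simp
  show thesis
  proof (rule that[of \<epsilon>])
    show "inj_on \<epsilon> {..<lift_dim k p}"
    proof (rule inj_onI)
      fix r s assume "r \<in> {..<lift_dim k p}" "s \<in> {..<lift_dim k p}" "\<epsilon> r = \<epsilon> s"
      then have "?MI ! r = ?MI ! s" using \<epsilon>[of r] \<epsilon>[of s] by simp
      with \<open>r \<in> _\<close> \<open>s \<in> _\<close> show "r = s"
        using distinct_multi_indices[of k p] by (simp add: nth_eq_iff_index_eq length_multi_indices)
    qed
    show "\<epsilon> ` {..<lift_dim k p} \<subseteq> {..<lift_dim (k + d) p}" using \<epsilon> by auto
  next
    fix x :: "real vec" and r assume x: "x \<in> carrier_vec k" and r: "r < lift_dim k p"
    show "lift_vec p (x @\<^sub>v 0\<^sub>v d) $ \<epsilon> r = lift_vec p x $ r"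
      using \<epsilon>[OF r] multi_indices_nth(1)[OF r]
      by (simp add: lift_vec_nth[OF x r] lift_vec_nth[OF append_carrier[OF x]]
          lift_coeff_append_zeros monomial_append_zeros[OF _ x])
  next
    fix x :: "real vec" and r
    assume x: "x \<in> carrier_vec k" and r: "r < lift_dim (k + d) p" and not: "r \<notin> \<epsilon> ` {..<lift_dim k p}"
    let ?\<alpha> = "?MI' ! r"
    have \<alpha>: "length ?\<alpha> = k + d" "sum_list ?\<alpha> = p" using multi_indices_nth[OF r] by auto
    have "\<exists>j<d. ?\<alpha> ! (k + j) > 0"
    proof (rule ccontr)
      assume "\<not> ?thesis"
      then have "drop k ?\<alpha> = replicate d 0"
        using \<alpha> by (intro nth_equalityI) auto
      then have eq: "?\<alpha> = take k ?\<alpha> @ replicate d 0"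
        by (metis append_take_drop_id)
      have "sum_list (take k ?\<alpha>) = p"
        using \<alpha>(2) eq by (metis add.right_neutral mult_zero_right sum_list_append sum_list_replicate)
      then obtain s where s: "s < lift_dim k p" "?MI ! s = take k ?\<alpha>"
        using multi_indices_nth_ex[of "take k ?\<alpha>" k p] \<alpha>(1) by auto
      then have "?MI' ! \<epsilon> s = ?MI' ! r" using \<epsilon>[OF s(1)] eq by simp
      then have "\<epsilon> s = r"
        using \<epsilon>[OF s(1)] r nth_eq_iff_index_eq[OF distinct_multi_indices[of "k + d" p], of "\<epsilon> s" r]
        by (simp add: length_multi_indices)
      with s(1) not show False by auto
    qed
    then show "lift_vec p (x @\<^sub>v 0\<^sub>v d) $ r = 0"
      using monomial_append_nonzero[OF x] by (auto simp: lift_vec_nth[OF append_carrier[OF x] r])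
  qed
qed

text \<open>Along the embedding \<open>\<epsilon>\<close> of coordinates, \<open>M'\<close> maps the vectors supported on the image of \<open>\<epsilon>\<close> to
  such vectors, and acts on them as \<open>M\<close> does. In coordinates adapted to \<open>\<epsilon>\<close>, \<open>M'\<close> is block upper
  triangular with the leading block \<open>M\<close>.\<close>

definition extends_by_zero_columns :: "(nat \<Rightarrow> nat) \<Rightarrow> nat \<Rightarrow> nat \<Rightarrow> 'a::zero mat \<Rightarrow> 'a mat \<Rightarrow> bool" where
  "extends_by_zero_columns \<epsilon> n n' M M' \<longleftrightarrow>
     (\<forall>c<n. (\<forall>r<n. M' $$ (\<epsilon> r, \<epsilon> c) = M $$ (r, c)) \<and>
        (\<forall>r<n'. r \<notin> \<epsilon> ` {..<n} \<longrightarrow> M' $$ (r, \<epsilon> c) = 0))"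

lemma sum_over_image:
  fixes \<epsilon> :: "nat \<Rightarrow> nat"
  assumes "inj_on \<epsilon> {..<n}" "\<epsilon> ` {..<n} \<subseteq> {..<n'}"
    and "\<And>c. c < n' \<Longrightarrow> c \<notin> \<epsilon> ` {..<n} \<Longrightarrow> g c = 0"
  shows "(\<Sum>c<n'. g c) = (\<Sum>c<n. g (\<epsilon> c))"
proof -
  have "(\<Sum>c<n'. g c) = sum g (\<epsilon> ` {..<n})"
    by (rule sum.mono_neutral_right) (use assms in auto)
  then show ?thesis by (simp add: sum.reindex[OF assms(1)])
qed

text \<open>If \<open>x\<close> solves the system of \<open>A\<close>, then \<open>(x, 0)\<close> solves the system of \<open>A'\<close>. The derivatives of the
  entries of \<open>(x, 0)\<^sup>[\<^sup>p\<^sup>]\<close>, which are those of \<open>x\<^sup>[\<^sup>p\<^sup>]\<close> and zeros, can therefore be expressed both by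
  the lift of \<open>A\<close> and by that of \<open>A'\<close>. Comparing coefficients, by the linear independence of the
  entries of \<open>x\<^sup>[\<^sup>p\<^sup>]\<close>, gives the columns of the lift of \<open>A'\<close> at the positions \<open>\<epsilon> c\<close>.\<close>

lemma lift_mat_extends:
  fixes k d p :: nat
  assumes A: "A \<in> carrier_mat k k" and A': "A' \<in> carrier_mat (k + d) (k + d)"
    and ext: "extends_by_zero_columns id k (k + d) A A'"
    and \<epsilon>: "inj_on \<epsilon> {..<lift_dim k p}" "\<epsilon> ` {..<lift_dim k p} \<subseteq> {..<lift_dim (k + d) p}"
    and emb: "\<And>x r. x \<in> carrier_vec k \<Longrightarrow> r < lift_dim k p \<Longrightarrow>
      lift_vec p (x @\<^sub>v 0\<^sub>v d) $ \<epsilon> r = lift_vec p x $ r"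
    and zero: "\<And>x r. x \<in> carrier_vec k \<Longrightarrow> r < lift_dim (k + d) p \<Longrightarrow> r \<notin> \<epsilon> ` {..<lift_dim k p} \<Longrightarrow>
      lift_vec p (x @\<^sub>v 0\<^sub>v d) $ r = 0"
  shows "extends_by_zero_columns \<epsilon> (lift_dim k p) (lift_dim (k + d) p) (lift_mat p A) (lift_mat p A')"
proof -
  let ?K = "lift_dim k p" and ?K' = "lift_dim (k + d) p"
  let ?B = "lift_mat p A" and ?B' = "lift_mat p A'"
  note gen = generates_lift_lift_mat[OF A, of p] and gen' = generates_lift_lift_mat[OF A', of p]
  have der: "((\<lambda>s. lift_vec p (x s @\<^sub>v 0\<^sub>v d) $ r) has_real_derivative
      (\<Sum>c<?K. ?B' $$ (r, \<epsilon> c) * lift_vec p (x t) $ c)) (at t)"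
    if x: "\<And>t. x t \<in> carrier_vec k" "\<And>t. has_vec_derivative_in k x (A *\<^sub>v x t) (at t)"
      and r: "r < ?K'" for x r t
  proof -
    let ?x = "\<lambda>t. x t @\<^sub>v 0\<^sub>v d"
    have x': "?x t \<in> carrier_vec (k + d)" for t using x(1)[of t] by simp
    have "has_vec_derivative_in (k + d) ?x (A' *\<^sub>v ?x t) (at t)" for t
      unfolding has_vec_derivative_in_def
    proof (intro allI impI)
      fix i assume i: "i < k + d"
      have "(A' *\<^sub>v ?x t) $ i = (\<Sum>j<k. A' $$ (i, j) * x t $ j)"
        unfolding mult_mat_vec_nth[OF A' x' i]
        by (rule trans[OF sum_over_image[of id k]]) (use x(1)[of t] in auto)
      also have "\<dots> = (if i < k then (A *\<^sub>v x t) $ i else 0)"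
        using ext i by (auto simp: mult_mat_vec_nth[OF A x(1)] extends_by_zero_columns_def)
      finally have *: "(A' *\<^sub>v ?x t) $ i = (if i < k then (A *\<^sub>v x t) $ i else 0)" .
      have "(\<lambda>t. ?x t $ i) = (if i < k then (\<lambda>t. x t $ i) else (\<lambda>_. 0))"
        using carrier_vecD[OF x(1)] i by auto
      then show "((\<lambda>t. ?x t $ i) has_real_derivative (A' *\<^sub>v ?x t) $ i) (at t)"
        using x(2)[of t] unfolding * has_vec_derivative_in_def by auto
    qed
    from generates_lift_nth[OF gen' x' this r]
    have "((\<lambda>s. lift_vec p (?x s) $ r) has_real_derivative
      (\<Sum>c<?K'. ?B' $$ (r, c) * lift_vec p (?x t) $ c)) (at t)" .
    also have "(\<Sum>c<?K'. ?B' $$ (r, c) * lift_vec p (?x t) $ c) =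
        (\<Sum>c<?K. ?B' $$ (r, \<epsilon> c) * lift_vec p (x t) $ c)"
      by (rule trans[OF sum_over_image[OF \<epsilon>]]) (auto simp: emb[OF x(1)] zero[OF x(1)])
    finally show ?thesis .
  qed
  have in_block: "?B' $$ (\<epsilon> r, \<epsilon> c) = ?B $$ (r, c)" if r: "r < ?K" and c: "c < ?K" for r c
  proof -
    have "(\<Sum>c<?K. (?B' $$ (\<epsilon> r, \<epsilon> c) - ?B $$ (r, c)) * lift_vec p x0 $ c) = 0"
      if x0: "x0 \<in> carrier_vec k" for x0
    proof -
      obtain x where x: "\<And>t. x t \<in> carrier_vec k" "x 0 = x0"
        "\<And>t. has_vec_derivative_in k x (A *\<^sub>v x t) (at t)"
        using linear_ode_solution_exists[OF A x0] by blast
      have "\<epsilon> r < ?K'" using \<epsilon>(2) r by auto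
      from der[OF x(1,3) this, of 0] have "((\<lambda>s. lift_vec p (x s) $ r) has_real_derivative
          (\<Sum>c<?K. ?B' $$ (\<epsilon> r, \<epsilon> c) * lift_vec p (x 0) $ c)) (at 0)"
        by (simp only: emb[OF x(1) r])
      from DERIV_unique[OF this generates_lift_nth[OF gen x(1,3) r]]
      show ?thesis by (simp add: x(2) left_diff_distrib sum_subtractf)
    qed
    from lift_vec_independent[OF this c] show ?thesis by simp
  qed
  have off_block: "?B' $$ (r, \<epsilon> c) = 0"
    if r: "r < ?K'" "r \<notin> \<epsilon> ` {..<?K}" and c: "c < ?K" for r c
  proof -
    have "(\<Sum>c<?K. ?B' $$ (r, \<epsilon> c) * lift_vec p x0 $ c) = 0" if x0: "x0 \<in> carrier_vec k" for x0
    proof -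
      obtain x where x: "\<And>t. x t \<in> carrier_vec k" "x 0 = x0"
        "\<And>t. has_vec_derivative_in k x (A *\<^sub>v x t) (at t)"
        using linear_ode_solution_exists[OF A x0] by blast
      from der[OF x(1,3) r(1), of 0] have "((\<lambda>s. 0) has_real_derivative
          (\<Sum>c<?K. ?B' $$ (r, \<epsilon> c) * lift_vec p (x 0) $ c)) (at 0)"
        by (simp only: zero[OF x(1) r])
      from DERIV_unique[OF this DERIV_const] show ?thesis by (simp add: x(2))
    qed
    from lift_vec_independent[OF this c] show ?thesis .
  qed
  show ?thesis unfolding extends_by_zero_columns_def using in_block off_block by simp
qed

section \<open>Monotonicity of the spectral abscissa\<close>

text \<open>An eigenvector of \<open>M\<close>, extended by zeros off the image of \<open>\<epsilon>\<close>, is an eigenvector of \<open>M'\<close>.\<close>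

lemma spectrum_extends:
  fixes M M' :: "'a::comm_ring_1 mat"
  assumes M: "M \<in> carrier_mat n n" and M': "M' \<in> carrier_mat n' n'"
    and \<epsilon>: "inj_on \<epsilon> {..<n}" "\<epsilon> ` {..<n} \<subseteq> {..<n'}" and ext: "extends_by_zero_columns \<epsilon> n n' M M'"
  shows "spectrum M \<subseteq> spectrum M'"
proof
  fix a assume "a \<in> spectrum M"
  then obtain v where v: "v \<in> carrier_vec n" "v \<noteq> 0\<^sub>v n" "M *\<^sub>v v = a \<cdot>\<^sub>v v"
    using M by (auto simp: spectrum_def eigenvalue_def eigenvector_def)
  define w where "w = vec n' (\<lambda>i. if i \<in> \<epsilon> ` {..<n} then v $ (the_inv_into {..<n} \<epsilon> i) else 0)"
  have w: "w \<in> carrier_vec n'" by (simp add: w_def)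
  have w_in: "w $ \<epsilon> i = v $ i" if "i < n" for i
    using that \<epsilon> by (auto simp: w_def the_inv_into_f_f)
  have w_off: "w $ i = 0" if "i < n'" "i \<notin> \<epsilon> ` {..<n}" for i
    using that by (simp add: w_def)
  obtain i where i: "i < n" "v $ i \<noteq> 0"
    using v(1,2) by (metis carrier_vecD eq_vecI index_zero_vec(1,2))
  have "w \<noteq> 0\<^sub>v n'"
  proof
    assume "w = 0\<^sub>v n'"
    moreover have "\<epsilon> i < n'" using \<epsilon>(2) i(1) by auto
    ultimately show False using w_in[OF i(1)] i(2) by simp
  qed
  moreover have "M' *\<^sub>v w = a \<cdot>\<^sub>v w"
  proof (rule eq_vecI)
    show "dim_vec (M' *\<^sub>v w) = dim_vec (a \<cdot>\<^sub>v w)" using M' w by simp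
    fix r assume "r < dim_vec (a \<cdot>\<^sub>v w)"
    then have r: "r < n'" using w by simp
    have "(M' *\<^sub>v w) $ r = (\<Sum>c<n. M' $$ (r, \<epsilon> c) * v $ c)"
      unfolding mult_mat_vec_nth[OF M' w r]
      by (rule trans[OF sum_over_image[OF \<epsilon>]]) (auto simp: w_in w_off)
    also have "\<dots> = (a \<cdot>\<^sub>v w) $ r"
    proof (cases "r \<in> \<epsilon> ` {..<n}")
      case True
      then obtain s where s: "s < n" "r = \<epsilon> s" by auto
      have "(\<Sum>c<n. M' $$ (r, \<epsilon> c) * v $ c) = (M *\<^sub>v v) $ s"
        unfolding mult_mat_vec_nth[OF M v(1) s(1)] using ext s
        by (intro sum.cong) (auto simp: extends_by_zero_columns_def)
      also have "\<dots> = a * v $ s" using v s by simp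
      finally show ?thesis using r w s w_in[OF s(1)] by simp
    next
      case False
      have "(\<Sum>c<n. M' $$ (r, \<epsilon> c) * v $ c) = 0"
        using ext False r by (intro sum.neutral) (auto simp: extends_by_zero_columns_def)
      then show ?thesis using r w w_off[OF r False] by simp
    qed
    finally show "(M' *\<^sub>v w) $ r = (a \<cdot>\<^sub>v w) $ r" .
  qed
  ultimately show "a \<in> spectrum M'"
    using w M' by (auto simp: spectrum_def eigenvalue_def eigenvector_def)
qed

lemma spectral_abscissa_extends:
  assumes M: "M \<in> carrier_mat n n" and M': "M' \<in> carrier_mat n' n'" and n: "n > 0"
    and \<epsilon>: "inj_on \<epsilon> {..<n}" "\<epsilon> ` {..<n} \<subseteq> {..<n'}" and ext: "extends_by_zero_columns \<epsilon> n n' M M'"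
  shows "spectral_abscissa M \<le> spectral_abscissa M'"
proof -
  let ?c = "map_mat complex_of_real"
  have c: "?c M \<in> carrier_mat n n" "?c M' \<in> carrier_mat n' n'" using M M' by auto
  have "extends_by_zero_columns \<epsilon> n n' (?c M) (?c M')"
  proof -
    have "\<epsilon> r < n'" if "r < n" for r using \<epsilon>(2) that by auto
    then show ?thesis using ext M M' by (auto simp: extends_by_zero_columns_def)
  qed
  from spectrum_extends[OF c \<epsilon> this] have "Re ` spectrum (?c M) \<subseteq> Re ` spectrum (?c M')"
    by (rule image_mono)
  then show ?thesis unfolding spectral_abscissa_def
    using spectrum_non_empty[OF c(1) n] card_finite_spectrum(1)[OF c(2)]
    by (intro Max_mono) auto
qed

section \<open>Kronecker products and block-diagonal matrices\<close>

lemma kron_index: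
  assumes "A \<in> carrier_mat r c" "B \<in> carrier_mat r' c'" "i < r * r'" "j < c * c'"
  shows "kron A B $$ (i, j) = A $$ (i div r', j div c') * B $$ (i mod r', j mod c')"
  using assms by (simp add: kron_def)

lemma kron_carrier:
  "A \<in> carrier_mat r c \<Longrightarrow> B \<in> carrier_mat r' c' \<Longrightarrow> kron A B \<in> carrier_mat (r * r') (c * c')"
  by (auto simp: kron_def)

lemma div_mod_less:
  fixes i :: nat
  assumes "i < m * n"
  shows "i div n < m" "i mod n < n"
proof -
  have "n > 0" using assms by (cases n) auto
  then show "i div n < m" "i mod n < n"
    using assms by (auto simp: less_mult_imp_div_less)
qed

lemma kron_sum_carrier:
  "A \<in> carrier_mat m m \<Longrightarrow> B \<in> carrier_mat n n \<Longrightarrow> kron_sum A B \<in> carrier_mat (m * n) (m * n)"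
  using kron_carrier[of A m m "1\<^sub>m n" n n] kron_carrier[of "1\<^sub>m m" m m B n n]
  by (simp add: kron_sum_def)

lemma kron_sum_index:
  assumes A: "A \<in> carrier_mat m m" and B: "B \<in> carrier_mat n n" and i: "i < m * n" and j: "j < m * n"
  shows "kron_sum A B $$ (i, j) = (if i mod n = j mod n then A $$ (i div n, j div n) else 0)
    + (if i div n = j div n then B $$ (i mod n, j mod n) else 0)"
proof -
  have "kron_sum A B $$ (i, j) = kron A (1\<^sub>m n) $$ (i, j) + kron (1\<^sub>m m) B $$ (i, j)"
    using A B i j kron_carrier[of "1\<^sub>m m" m m B n n]
    by (simp add: kron_sum_def)
  then show ?thesis
    using div_mod_less[OF i] div_mod_less[OF j]
    by (simp add: kron_index[OF A one_carrier_mat i j] kron_index[OF one_carrier_mat B i j])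
qed

lemma diag_block_mat_uniform:
  assumes "\<forall>B\<in>set Bs. B \<in> carrier_mat K K"
  shows diag_block_mat_uniform_carrier: "diag_block_mat Bs \<in> carrier_mat (length Bs * K) (length Bs * K)"
    and "i < length Bs * K \<Longrightarrow> j < length Bs * K \<Longrightarrow> diag_block_mat Bs $$ (i, j) =
      (if i div K = j div K then (Bs ! (i div K)) $$ (i mod K, j mod K) else 0)"
proof -
  show carrier: "diag_block_mat Bs \<in> carrier_mat (length Bs * K) (length Bs * K)"
    using assms by (induction Bs) (auto simp: Let_def)
  show "diag_block_mat Bs $$ (i, j) =
      (if i div K = j div K then (Bs ! (i div K)) $$ (i mod K, j mod K) else 0)"
    if "i < length Bs * K" "j < length Bs * K"
    using assms that
  proof (induction Bs arbitrary: i j)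
    case Nil
    then show ?case by simp
  next
    case (Cons B Bs)
    have B: "B \<in> carrier_mat K K" and Bs: "\<forall>B\<in>set Bs. B \<in> carrier_mat K K"
      using Cons.prems(1) by auto
    have D: "diag_block_mat Bs \<in> carrier_mat (length Bs * K) (length Bs * K)"
      using Bs by (induction Bs) (auto simp: Let_def)
    have K: "K > 0" using Cons.prems(2) by (cases K) auto
    have shift: "i div K = Suc ((i - K) div K)" "i mod K = (i - K) mod K" if "\<not> i < K" for i
      using that K by (auto simp: le_div_geq le_mod_geq)
    have "diag_block_mat (B # Bs) $$ (i, j) =
        (if i < K then if j < K then B $$ (i, j) else 0
         else if j < K then 0 else diag_block_mat Bs $$ (i - K, j - K))"
      using B D Cons.prems(2,3) by (auto simp: Let_def)
    moreover have "diag_block_mat Bs $$ (i - K, j - K) =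
        (if (i - K) div K = (j - K) div K then (Bs ! ((i - K) div K)) $$ ((i - K) mod K, (j - K) mod K) else 0)"
      if "\<not> i < K" "\<not> j < K"
      using Cons.IH[OF Bs, of "i - K" "j - K"] Cons.prems(2,3) that by auto
    ultimately show ?case
      by (cases "i < K"; cases "j < K") (simp_all add: shift)
  qed
qed

text \<open>The index \<open>q\<close> of the large matrix stands for entry \<open>q mod K\<close> of block \<open>q div K\<close>, so \<open>\<eta>\<close> applies
  \<open>\<epsilon>\<close> inside each block. The factor \<open>Q\<close> only couples equal entries of the blocks, and the
  injectivity of \<open>\<epsilon>\<close> preserves this pattern.\<close>

lemma block_diagonal_extends:
  fixes Q :: "'a::comm_ring_1 mat" and K K' N :: nat
  assumes Q: "Q \<in> carrier_mat N N"
    and B: "\<And>i. i < N \<Longrightarrow> B i \<in> carrier_mat K K" and B': "\<And>i. i < N \<Longrightarrow> B' i \<in> carrier_mat K' K'"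
    and \<epsilon>: "inj_on \<epsilon> {..<K}" "\<epsilon> ` {..<K} \<subseteq> {..<K'}"
    and ext: "\<And>i. i < N \<Longrightarrow> extends_by_zero_columns \<epsilon> K K' (B i) (B' i)"
  defines "\<eta> \<equiv> \<lambda>q. (q div K) * K' + \<epsilon> (q mod K)"
  shows "inj_on \<eta> {..<N * K}" "\<eta> ` {..<N * K} \<subseteq> {..<N * K'}"
    and "extends_by_zero_columns \<eta> (N * K) (N * K')
      (kron Q (1\<^sub>m K) + diag_block_mat (map B [0..<N]))
      (kron Q (1\<^sub>m K') + diag_block_mat (map B' [0..<N]))"
proof -
  have \<epsilon>_less: "\<epsilon> r < K'" if "r < K" for r using \<epsilon>(2) that by auto
  have \<eta>_div: "\<eta> q div K' = q div K" and \<eta>_mod: "\<eta> q mod K' = \<epsilon> (q mod K)" and \<eta>_less: "\<eta> q < N * K'"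
    if "q < N * K" for q
  proof -
    note e = \<epsilon>_less[OF div_mod_less(2)[OF that]]
    show "\<eta> q div K' = q div K" "\<eta> q mod K' = \<epsilon> (q mod K)"
      using e by (auto simp: \<eta>_def)
    have "(q div K) * K' + \<epsilon> (q mod K) < Suc (q div K) * K'" using e by simp
    also have "\<dots> \<le> N * K'"
      using div_mod_less(1)[OF that] by (intro mult_le_mono1) simp
    finally show "\<eta> q < N * K'" by (simp add: \<eta>_def)
  qed
  show "\<eta> ` {..<N * K} \<subseteq> {..<N * K'}" using \<eta>_less by auto
  show "inj_on \<eta> {..<N * K}"
  proof (rule inj_onI)
    fix q s assume q: "q \<in> {..<N * K}" and s: "s \<in> {..<N * K}" and eq: "\<eta> q = \<eta> s"
    have "q div K = s div K" using eq \<eta>_div q s by (metis lessThan_iff)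
    moreover have "\<epsilon> (q mod K) = \<epsilon> (s mod K)" using eq \<eta>_mod q s by (metis lessThan_iff)
    then have "q mod K = s mod K"
      using inj_onD[OF \<epsilon>(1)] div_mod_less(2)[of q N K] div_mod_less(2)[of s N K] q s by simp
    ultimately show "q = s" by (metis div_mult_mod_eq)
  qed
  let ?T = "\<lambda>L B. kron Q (1\<^sub>m L) + diag_block_mat (map B [0..<N])"
  have index: "?T L C $$ (i, j) = (if i mod L = j mod L then Q $$ (i div L, j div L) else 0)
      + (if i div L = j div L then C (i div L) $$ (i mod L, j mod L) else 0)"
    if C: "\<And>i. i < N \<Longrightarrow> C i \<in> carrier_mat L L" and i: "i < N * L" and j: "j < N * L" for L C i j
  proof -
    have *: "\<forall>B\<in>set (map C [0..<N]). B \<in> carrier_mat L L"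
      using C by auto
    note D = diag_block_mat_uniform[OF *]
    show ?thesis
      using D(1) D(2)[where i = i and j = j] kron_index[OF Q one_carrier_mat i j] i j div_mod_less[OF i] div_mod_less[OF j]
      by simp
  qed
  show "extends_by_zero_columns \<eta> (N * K) (N * K') (?T K B) (?T K' B')"
    unfolding extends_by_zero_columns_def
  proof (intro allI impI conjI)
    fix c r assume c: "c < N * K" and r: "r < N * K"
    have "\<epsilon> (r mod K) = \<epsilon> (c mod K) \<longleftrightarrow> r mod K = c mod K"
      using inj_on_eq_iff[OF \<epsilon>(1)] div_mod_less(2)[OF c] div_mod_less(2)[OF r] by simp
    moreover have "B' i $$ (\<epsilon> (r mod K), \<epsilon> (c mod K)) = B i $$ (r mod K, c mod K)" if "i < N" for i
      using ext[OF that] div_mod_less(2)[OF c] div_mod_less(2)[OF r]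
      by (simp add: extends_by_zero_columns_def)
    ultimately show "?T K' B' $$ (\<eta> r, \<eta> c) = ?T K B $$ (r, c)"
      using div_mod_less(1)[OF r]
      by (simp add: index[OF B r c] index[OF B' \<eta>_less[OF r] \<eta>_less[OF c]] \<eta>_div \<eta>_mod c r)
  next
    fix c r assume c: "c < N * K" and r: "r < N * K'" and off: "r \<notin> \<eta> ` {..<N * K}"
    have "r mod K' \<notin> \<epsilon> ` {..<K}"
    proof
      assume "r mod K' \<in> \<epsilon> ` {..<K}"
      then obtain s where s: "s < K" "r mod K' = \<epsilon> s" by auto
      let ?q = "(r div K') * K + s"
      have "?q < Suc (r div K') * K" using s by simp
      also have "\<dots> \<le> N * K"
        using div_mod_less(1)[OF r] by (intro mult_le_mono1) simp
      finally have "?q < N * K" .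
      moreover have "\<eta> ?q = r" using s by (simp add: \<eta>_def flip: s(2))
      ultimately show False using off by (metis imageI lessThan_iff)
    qed
    then have "B' i $$ (r mod K', \<epsilon> (c mod K)) = 0" if "i < N" for i
      using ext[OF that] div_mod_less(2)[OF c] div_mod_less(2)[OF r]
      by (simp add: extends_by_zero_columns_def)
    moreover have "r mod K' \<noteq> \<epsilon> (c mod K)"
      using \<open>r mod K' \<notin> \<epsilon> ` {..<K}\<close> div_mod_less(2)[OF c] by auto
    ultimately show "?T K' B' $$ (r, \<eta> c) = 0"
      using div_mod_less(1)[OF r]
      by (simp add: index[OF B' r \<eta>_less[OF c]] \<eta>_div \<eta>_mod c)
  qed
qed

section \<open>Padding with constant coordinates\<close>

text \<open>The additional coordinates have derivative zero. They stay constant, so they do not destroy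
  stability.\<close>

definition pad_zeros :: "nat \<Rightarrow> real mat \<Rightarrow> real mat" where
  "pad_zeros d M = four_block_mat M (0\<^sub>m (dim_row M) d) (0\<^sub>m d (dim_col M)) (0\<^sub>m d d)"

lemma pad_zeros_carrier: "M \<in> carrier_mat m m \<Longrightarrow> pad_zeros d M \<in> carrier_mat (m + d) (m + d)"
  by (simp add: pad_zeros_def)

lemma pad_zeros_index:
  "M \<in> carrier_mat m m \<Longrightarrow> i < m + d \<Longrightarrow> j < m + d \<Longrightarrow>
    pad_zeros d M $$ (i, j) = (if i < m \<and> j < m then M $$ (i, j) else 0)"
  by (simp add: pad_zeros_def)

text \<open>In a Kronecker sum the index of the left factor is the leading one, so the first \<open>mn\<close> indices
  are exactly those that belong to the original block of \<open>W\<close>.\<close>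

lemma kron_sum_pad_zeros_extends:
  assumes W: "W \<in> carrier_mat m m" and A: "A \<in> carrier_mat n n"
  shows "extends_by_zero_columns id (m * n) (m * n + d * n) (kron_sum W A) (kron_sum (pad_zeros d W) A)"
proof -
  have idx: "kron_sum (pad_zeros d W) A $$ (r, c) =
      (if r mod n = c mod n then pad_zeros d W $$ (r div n, c div n) else 0)
        + (if r div n = c div n then A $$ (r mod n, c mod n) else 0)"
    if "r < m * n + d * n" "c < m * n + d * n" for r c
    using that by (intro kron_sum_index[OF pad_zeros_carrier[OF W] A]) (auto simp: add_mult_distrib)
  have dv: "r div n < m + d" if "r < m * n + d * n" for r
    using that by (intro div_mod_less(1)[of r]) (simp add: add_mult_distrib)
  show ?thesis
    unfolding extends_by_zero_columns_def
  proof (intro allI impI conjI)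
    fix c r assume c: "c < m * n" and r: "r < m * n"
    then show "kron_sum (pad_zeros d W) A $$ (id r, id c) = kron_sum W A $$ (r, c)"
      using div_mod_less(1)[OF c] div_mod_less(1)[OF r]
      by (simp add: idx kron_sum_index[OF W A r c] pad_zeros_index[OF W])
  next
    fix c r assume c: "c < m * n" and r: "r < m * n + d * n" and "r \<notin> id ` {..<m * n}"
    then have r': "m * n \<le> r" by auto
    have "n > 0" using c by (cases n) auto
    then have "m \<le> r div n" using r' by (simp add: less_eq_div_iff_mult_less_eq)
    then show "kron_sum (pad_zeros d W) A $$ (r, id c) = 0"
      using div_mod_less(1)[OF c] dv[OF r] r c by (simp add: idx pad_zeros_index[OF W])
  qed
qed

text \<open>Split the interval at the exceptional points; the continuity of \<open>f\<close> carries its value across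
  them.\<close>

lemma constant_if_derivative_zero_except_finite:
  fixes f :: "real \<Rightarrow> real"
  assumes "finite D" "a \<le> b" "continuous_on {a..b} f"
    and "\<And>x. a < x \<Longrightarrow> x < b \<Longrightarrow> x \<notin> D \<Longrightarrow> (f has_real_derivative 0) (at x)"
  shows "f b = f a"
  using assms
proof (induction D arbitrary: a b rule: finite_induct)
  case empty
  then show ?case by (cases "a = b") (auto intro: DERIV_isconst_end)
next
  case (insert e D)
  show ?case
  proof (cases "a < e \<and> e < b")
    case True
    have "f e = f a"
      by (rule insert.IH) (use True insert.prems in \<open>auto intro: continuous_on_subset\<close>)
    moreover have "f b = f e"
      by (rule insert.IH) (use True insert.prems in \<open>auto intro: continuous_on_subset\<close>)
    ultimately show ?thesis by simp
  next
    case False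
    show ?thesis
      by (rule insert.IH) (use False insert.prems in auto)
  qed
qed

lemma vec_norm2_split:
  assumes "y \<in> carrier_vec (m + d)"
  shows "(vec_norm2 y)\<^sup>2 = (vec_norm2 (vec m (($) y)))\<^sup>2 + (\<Sum>i<d. (y $ (m + i))\<^sup>2)"
proof -
  have sq: "(vec_norm2 x)\<^sup>2 = (\<Sum>i<dim_vec x. (x $ i)\<^sup>2)" for x
    by (simp add: vec_norm2_def scalar_prod_def sum_nonneg atLeast0LessThan power2_eq_square)
  have "(\<Sum>i<m + d. (y $ i)\<^sup>2) = (\<Sum>i<m. (y $ i)\<^sup>2) + (\<Sum>i<d. (y $ (m + i))\<^sup>2)"
    by (induction d) auto
  then show ?thesis using assms by (simp add: sq)
qed

text \<open>The first \<open>m\<close> coordinates of a solution solve the original system, and the others are constant.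
  The stability constant must be at least 1 to cover the latter.\<close>

lemma switched_stable_pad_zeros:
  assumes W: "\<And>i. i < N \<Longrightarrow> W i \<in> carrier_mat m m" and stable: "switched_stable m N W"
  shows "switched_stable (m + d) N (\<lambda>i. pad_zeros d (W i))"
proof -
  obtain C where C: "C > 0" and bound: "\<And>\<sigma> y t. switching_signal N \<sigma> \<Longrightarrow> switched_solution m W \<sigma> y \<Longrightarrow>
      0 \<le> t \<Longrightarrow> vec_norm2 (y t) \<le> C * vec_norm2 (y 0)"
    using stable unfolding switched_stable_def by blast
  have "vec_norm2 (y t) \<le> max 1 C * vec_norm2 (y 0)"
    if sig: "switching_signal N \<sigma>" and sol: "switched_solution (m + d) (\<lambda>i. pad_zeros d (W i)) \<sigma> y"
      and t: "0 \<le> t" for \<sigma> y t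
  proof -
    obtain D where D: "locally_finite_times D" and
      y: "\<And>t. t \<ge> 0 \<Longrightarrow> y t \<in> carrier_vec (m + d)" and
      cont: "\<And>i. i < m + d \<Longrightarrow> continuous_on {0..} (\<lambda>t. y t $ i)" and
      deriv: "\<And>t i. t \<ge> 0 \<Longrightarrow> t \<notin> D \<Longrightarrow> i < m + d \<Longrightarrow>
        ((\<lambda>t. y t $ i) has_real_derivative (pad_zeros d (W (\<sigma> t)) *\<^sub>v y t) $ i) (at t within {0..})"
      using sol unfolding switched_solution_def has_vec_derivative_in_def by auto
    define z where "z t = vec m (($) (y t))" for t
    have rhs: "(pad_zeros d (W (\<sigma> t)) *\<^sub>v y t) $ i = (if i < m then (W (\<sigma> t) *\<^sub>v z t) $ i else 0)"
      if "t \<ge> 0" "i < m + d" for t i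
    proof -
      have Wt: "W (\<sigma> t) \<in> carrier_mat m m"
        using W sig that(1) by (auto simp: switching_signal_def)
      have z: "z t \<in> carrier_vec m" by (simp add: z_def)
      have "(pad_zeros d (W (\<sigma> t)) *\<^sub>v y t) $ i =
          (\<Sum>j<m. pad_zeros d (W (\<sigma> t)) $$ (i, j) * y t $ j)"
        unfolding mult_mat_vec_nth[OF pad_zeros_carrier[OF Wt] y[OF that(1)] that(2)]
        by (rule sum.mono_neutral_right) (use that in \<open>auto simp: pad_zeros_index[OF Wt]\<close>)
      also have "\<dots> = (\<Sum>j<m. pad_zeros d (W (\<sigma> t)) $$ (i, j) * z t $ j)"
        by (simp add: z_def)
      also have "\<dots> = (if i < m then (W (\<sigma> t) *\<^sub>v z t) $ i else 0)"
        using that by (auto simp: mult_mat_vec_nth[OF Wt z] pad_zeros_index[OF Wt])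
      finally show ?thesis .
    qed
    have "switched_solution m W \<sigma> z"
      unfolding switched_solution_def has_vec_derivative_in_def
    proof (intro conjI allI impI exI[of _ D] ballI)
      show "locally_finite_times D" by (rule D)
      show "z t \<in> carrier_vec m" for t by (simp add: z_def)
      show "continuous_on {0..} (\<lambda>t. z t $ i)" if "i < m" for i
        using cont[of i] that by (simp add: z_def)
      show "((\<lambda>t. z t $ i) has_real_derivative (W (\<sigma> t) *\<^sub>v z t) $ i) (at t within {0..})"
        if "t \<in> {0..} - D" "i < m" for t i
        using deriv[of t i] rhs[of t i] that by (simp add: z_def)
    qed
    from bound[OF sig this t] have z_bound: "vec_norm2 (z t) \<le> C * vec_norm2 (z 0)" .
    have const: "y t $ (m + i) = y 0 $ (m + i)" if "i < d" for i
    proof (rule constant_if_derivative_zero_except_finite[where f = "\<lambda>t. y t $ (m + i)" and D = "D \<inter> {0..t}"])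
      show "finite (D \<inter> {0..t})" using D by (simp add: locally_finite_times_def)
      show "continuous_on {0..t} (\<lambda>t. y t $ (m + i))"
        using cont[of "m + i"] that by (auto intro: continuous_on_subset)
      show "((\<lambda>t. y t $ (m + i)) has_real_derivative 0) (at x)"
        if x: "0 < x" "x < t" "x \<notin> D \<inter> {0..t}" for x
      proof -
        have "at x within {0..} = at x"
          by (rule at_within_open_subset[of x "{0<..}"]) (use x(1) in auto)
        with deriv[of x "m + i"] rhs[of x "m + i"] x \<open>i < d\<close> show ?thesis by simp
      qed
    qed (rule t)
    let ?C = "max 1 C"
    have norm_nonneg: "vec_norm2 x \<ge> 0" for x
      by (simp add: vec_norm2_def scalar_prod_def sum_nonneg)
    have "vec_norm2 (z t) \<le> ?C * vec_norm2 (z 0)"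
      using z_bound by (rule order_trans) (intro mult_right_mono norm_nonneg, simp)
    then have "(vec_norm2 (z t))\<^sup>2 \<le> ?C\<^sup>2 * (vec_norm2 (z 0))\<^sup>2"
      using norm_nonneg power_mono[of "vec_norm2 (z t)" "?C * vec_norm2 (z 0)" 2]
      by (simp add: power_mult_distrib)
    moreover have "(\<Sum>i<d. (y t $ (m + i))\<^sup>2) = (\<Sum>i<d. (y 0 $ (m + i))\<^sup>2)"
      using const by simp
    moreover have "1 * (\<Sum>i<d. (y 0 $ (m + i))\<^sup>2) \<le> ?C\<^sup>2 * (\<Sum>i<d. (y 0 $ (m + i))\<^sup>2)"
      by (intro mult_right_mono one_le_power sum_nonneg) auto
    ultimately have "(vec_norm2 (y t))\<^sup>2 \<le> ?C\<^sup>2 * (vec_norm2 (y 0))\<^sup>2"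
      using y[OF t] y[of 0] by (simp add: vec_norm2_split[where m = m and d = d] distrib_left flip: z_def)
    then have "(vec_norm2 (y t))\<^sup>2 \<le> (?C * vec_norm2 (y 0))\<^sup>2"
      by (simp add: power_mult_distrib)
    then show ?thesis
      by (rule power2_le_imp_le) (intro mult_nonneg_nonneg norm_nonneg, simp)
  qed
  moreover have "max 1 C > 0" by simp
  ultimately show ?thesis unfolding switched_stable_def by blast
qed

lemma T_hat_carrier:
  assumes W: "\<And>i. i < N \<Longrightarrow> W i \<in> carrier_mat m m" and A: "\<And>i. i < N \<Longrightarrow> A i \<in> carrier_mat n n"
    and Q: "Q \<in> carrier_mat N N"
  shows "T_hat n N p A Q m W \<in> carrier_mat (N * lift_dim (m * n) p) (N * lift_dim (m * n) p)"
proof -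
  have "\<forall>B\<in>set (map (\<lambda>i. lift_mat p (kron_sum (W i) (A i))) [0..<N]).
      B \<in> carrier_mat (lift_dim (m * n) p) (lift_dim (m * n) p)"
    by (auto intro!: lift_mat_carrier kron_sum_carrier W A)
  from diag_block_mat_uniform_carrier[OF this] show ?thesis
    unfolding T_hat_def by (intro add_carrier_mat) simp
qed

text \<open>The relation of being extended by zero columns passes from the Kronecker sums to their lifts and
  from these to the block matrices, where it gives an inclusion of the spectra.\<close>

lemma spectral_abscissa_T_hat_pad_zeros:
  assumes n: "n > 0" and N: "N > 0" and m: "m > 0"
    and W: "\<And>i. i < N \<Longrightarrow> W i \<in> carrier_mat m m" and A: "\<And>i. i < N \<Longrightarrow> A i \<in> carrier_mat n n"
    and Q: "Q \<in> carrier_mat N N"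
  shows "spectral_abscissa (T_hat n N p A Q m W)
    \<le> spectral_abscissa (T_hat n N p A Q (m + d) (\<lambda>i. pad_zeros d (W i)))"
proof -
  let ?k = "m * n" and ?k' = "m * n + d * n"
  let ?K = "lift_dim ?k p" and ?K' = "lift_dim ?k' p"
  have dim: "(m + d) * n = ?k'" by (simp add: add_mult_distrib)
  obtain \<epsilon> where \<epsilon>: "inj_on \<epsilon> {..<?K}" "\<epsilon> ` {..<?K} \<subseteq> {..<?K'}"
    and emb: "\<And>x r. x \<in> carrier_vec ?k \<Longrightarrow> r < ?K \<Longrightarrow>
      lift_vec p (x @\<^sub>v 0\<^sub>v (d * n)) $ \<epsilon> r = lift_vec p x $ r"
    and zero: "\<And>x r. x \<in> carrier_vec ?k \<Longrightarrow> r < ?K' \<Longrightarrow> r \<notin> \<epsilon> ` {..<?K} \<Longrightarrow>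
      lift_vec p (x @\<^sub>v 0\<^sub>v (d * n)) $ r = 0"
    using lift_vec_append_zeros[of ?k p "d * n"] by metis
  let ?B = "\<lambda>i. lift_mat p (kron_sum (W i) (A i))"
  let ?B' = "\<lambda>i. lift_mat p (kron_sum (pad_zeros d (W i)) (A i))"
  have S: "kron_sum (W i) (A i) \<in> carrier_mat ?k ?k"
    and S': "kron_sum (pad_zeros d (W i)) (A i) \<in> carrier_mat ?k' ?k'" if "i < N" for i
    using kron_sum_carrier[OF W A, OF that that]
      kron_sum_carrier[OF pad_zeros_carrier[OF W] A, OF that that, of d] by (simp_all only: dim)
  have B: "?B i \<in> carrier_mat ?K ?K" and B': "?B' i \<in> carrier_mat ?K' ?K'" if "i < N" for i
    using lift_mat_carrier S[OF that] S'[OF that] by blast+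
  have "extends_by_zero_columns \<epsilon> ?K ?K' (?B i) (?B' i)" if "i < N" for i
    by (rule lift_mat_extends[OF S[OF that] S'[OF that]
          kron_sum_pad_zeros_extends[OF W[OF that] A[OF that]] \<epsilon> emb zero])
  note ext = block_diagonal_extends[OF transpose_carrier_mat[THEN iffD2, OF Q] B B' \<epsilon> this]
  have carrier: "T_hat n N p A Q m W \<in> carrier_mat (N * ?K) (N * ?K)"
    by (rule T_hat_carrier[OF W A Q])
  have carrier': "T_hat n N p A Q (m + d) (\<lambda>i. pad_zeros d (W i)) \<in> carrier_mat (N * ?K') (N * ?K')"
    using T_hat_carrier[of N "\<lambda>i. pad_zeros d (W i)" "m + d" A n Q p] pad_zeros_carrier[OF W] A Q
    by (simp only: dim)
  have "m * n > 0" using n m by simp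
  then have "p \<le> m * n + p - 1" by linarith
  then have "N * ?K > 0" using N unfolding lift_dim_def by (simp only: zero_less_binomial mult_pos_pos)
  from spectral_abscissa_extends[OF carrier carrier' this ext(1,2)] ext(3) show ?thesis
    by (simp only: T_hat_def dim)
qed

section \<open>Monotonicity in the dimension\<close>

theorem proposition4:
  fixes n N p m m' :: nat and A :: "nat \<Rightarrow> real mat" and Q :: "real mat"
  assumes "n > 0" and "N > 0" and "p > 0"
    and "\<And>i. i < N \<Longrightarrow> A i \<in> carrier_mat n n"
    and "markov_generator N Q"
    and "m > 0" and "m' > 0" and "m < m'"
  shows "sup_abscissa n N p A Q m \<le> sup_abscissa n N p A Q m'"
  unfolding sup_abscissa_def
proof (rule SUP_mono, safe)
  fix W assume W: "\<forall>i<N. W i \<in> carrier_mat m m" and stable: "switched_stable m N W"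
  define d where "d = m' - m"
  have m': "m' = m + d" using assms(8) by (simp add: d_def)
  have Q: "Q \<in> carrier_mat N N" using assms(5) by (simp add: markov_generator_def)
  show "\<exists>W'\<in>{W. (\<forall>i<N. W i \<in> carrier_mat m' m') \<and> switched_stable m' N W}.
      ereal (spectral_abscissa (T_hat n N p A Q m W)) \<le> ereal (spectral_abscissa (T_hat n N p A Q m' W'))"
  proof (rule bexI[of _ "\<lambda>i. pad_zeros d (W i)"])
    show "ereal (spectral_abscissa (T_hat n N p A Q m W))
        \<le> ereal (spectral_abscissa (T_hat n N p A Q m' (\<lambda>i. pad_zeros d (W i))))"
      unfolding m' using spectral_abscissa_T_hat_pad_zeros[OF assms(1,2,6)] W assms(4) Q by simp
    show "(\<lambda>i. pad_zeros d (W i)) \<in> {W. (\<forall>i<N. W i \<in> carrier_mat m' m') \<and> switched_stable m' N W}"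
      unfolding m' using switched_stable_pad_zeros[OF _ stable] pad_zeros_carrier W by simp
  qed
qed

end
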